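(* Let $\mathcal{L}$ be the Heisenberg-Virasoro algebra, and let $M$ be a $U(\mathcal{L})$-module whose restriction to $U(\mathbb{C}L_0)$ is free of rank $1$. Then $M\cong\Omega(\lambda,\alpha,\beta)$ as $\mathcal{L}$-modules for some $\alpha,\beta\in\mathbb{C}$ and $\lambda\in\mathbb{C}^*$. Moreover, $M$ is simple if and only if $M\cong\Omega(\lambda,\alpha,\beta)$ for some $\lambda\in\mathbb{C}^*$ and $\alpha,\beta\in\mathbb{C}$ with $\alpha\neq 0$ or $\beta\neq 0$.
   Context: $\mathbb{C}^*=\mathbb{C}\setminus\{0\}$, and $U(\cdot)$ denotes the universal enveloping algebra. The Heisenberg-Virasoro algebra $\mathcal{L}$ is the complex Lie algebra with basis $\{L_n, I_n, C_1, C_2, C_3 \mid n\in\mathbb{Z}\}$ and brackets, for all $m,n\in\mathbb{Z}$, $$[L_m,L_n]=(n-m)L_{m+n}+\delta_{m+n,0}\frac{m^3-m}{12}C_1,$$ $$[L_m,I_n]=nI_{m+n}+\delta_{m+n,0}(m^2+m)C_2,$$ $$[I_m,I_n]=m\,\delta_{m+n,0}C_3,$$ where $C_1,C_2,C_3$ are central (so that $C_1,C_2,C_3,I_0$ span the center). For $\lambda\in\mathbb{C}^*$ and $\alpha,\beta\in\mathbb{C}$, $\Omega(\lambda,\alpha,\beta)$ is the $\mathcal{L}$-module with underlying space the polynomial algebra $\mathbb{C}[t]$ and action $$C_jf(t)=0,\qquad L_mf(t)=\lambda^m(t-m\alpha)f(t-m),\qquad I_mf(t)=\beta\lambda^mf(t-m),$$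 for $f(t)\in\mathbb{C}[t]$, $m\in\mathbb{Z}$, $j=1,2,3$. *)

theory Defs
  imports
    Complex_Main
    "HOL-Algebra.QuotRing"
    "HOL-Algebra.Module"
    "HOL-Library.Poly_Mapping"
    "HOL-Computational_Algebra.Polynomial"
begin

section \<open>Modules over non-commutative rings\<close>

text \<open>The locale \<^locale>\<open>module\<close> requires a commutative ring; this is the same list of axioms
  over an arbitrary ring. The fields \<open>mult\<close> and \<open>one\<close> of the module record are irrelevant, and
  \<^locale>\<open>submodule\<close> makes sense over any ring.\<close>

locale left_module = R?: ring R + M?: abelian_group M
  for R (structure) and M (structure) +
  assumes smult_closed [simp, intro]:
      "\<lbrakk>a \<in> carrier R; x \<in> carrier M\<rbrakk> \<Longrightarrow> a \<odot>\<^bsub>M\<^esub> x \<in> carrier M"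
    and smult_l_distr:
      "\<lbrakk>a \<in> carrier R; b \<in> carrier R; x \<in> carrier M\<rbrakk> \<Longrightarrow>
        (a \<oplus> b) \<odot>\<^bsub>M\<^esub> x = a \<odot>\<^bsub>M\<^esub> x \<oplus>\<^bsub>M\<^esub> b \<odot>\<^bsub>M\<^esub> x"
    and smult_r_distr:
      "\<lbrakk>a \<in> carrier R; x \<in> carrier M; y \<in> carrier M\<rbrakk> \<Longrightarrow>
        a \<odot>\<^bsub>M\<^esub> (x \<oplus>\<^bsub>M\<^esub> y) = a \<odot>\<^bsub>M\<^esub> x \<oplus>\<^bsub>M\<^esub> a \<odot>\<^bsub>M\<^esub> y"
    and smult_assoc1:
      "\<lbrakk>a \<in> carrier R; b \<in> carrier R; x \<in> carrier M\<rbrakk> \<Longrightarrow>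
        (a \<otimes> b) \<odot>\<^bsub>M\<^esub> x = a \<odot>\<^bsub>M\<^esub> (b \<odot>\<^bsub>M\<^esub> x)"
    and smult_one [simp]:
      "x \<in> carrier M \<Longrightarrow> \<one> \<odot>\<^bsub>M\<^esub> x = x"

definition simple_module :: "('a, 'r) ring_scheme \<Rightarrow> ('a, 'b, 's) module_scheme \<Rightarrow> bool" where
  "simple_module R M \<longleftrightarrow> left_module R M \<and> carrier M \<noteq> {\<zero>\<^bsub>M\<^esub>} \<and>
     (\<forall>N. submodule N R M \<longrightarrow> N = {\<zero>\<^bsub>M\<^esub>} \<or> N = carrier M)"

definition free_of_rank_one :: "('a, 'r) ring_scheme \<Rightarrow> ('a, 'b, 's) module_scheme \<Rightarrow> bool" where
  "free_of_rank_one R M \<longleftrightarrow> left_module R M \<and>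
     (\<exists>v \<in> carrier M. bij_betw (\<lambda>a. a \<odot>\<^bsub>M\<^esub> v) (carrier R) (carrier M))"

definition restrict_scalars :: "('a \<Rightarrow> 'a) \<Rightarrow> ('a, 'b, 's) module_scheme \<Rightarrow> ('a, 'b, 's) module_scheme" where
  "restrict_scalars h M = M\<lparr>smult := \<lambda>a x. h a \<odot>\<^bsub>M\<^esub> x\<rparr>"


section \<open>Lie algebras and universal enveloping algebras\<close>

locale lie_algebra = vector_space scale
  for scale :: "complex \<Rightarrow> 'g::ab_group_add \<Rightarrow> 'g" +
  fixes bracket :: "'g \<Rightarrow> 'g \<Rightarrow> 'g"
  assumes bracket_add_left: "bracket (x + y) z = bracket x z + bracket y z"
    and bracket_add_right: "bracket x (y + z) = bracket x y + bracket x z"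
    and bracket_scale_left: "bracket (scale c x) y = scale c (bracket x y)"
    and bracket_scale_right: "bracket x (scale c y) = scale c (bracket x y)"
    and bracket_self: "bracket x x = 0"
    and jacobi: "bracket x (bracket y z) + bracket y (bracket z x) + bracket z (bracket x y) = 0"

text \<open>Words form the free monoid, written additively because this is what the convolution product
  of \<^typ>\<open>'a \<Rightarrow>\<^sub>0 complex\<close> refers to. A separate type keeps the type class instance away from
  \<^typ>\<open>'a list\<close>.\<close>

datatype 'a wd = Wd (letters: "'a list")

instantiation wd :: (type) monoid_add
begin
definition zero_wd :: "'a wd" where "zero_wd = Wd []"
definition plus_wd :: "'a wd \<Rightarrow> 'a wd \<Rightarrow> 'a wd" where
  "plus_wd u v = Wd (letters u @ letters v)"
instance by standard (simp_all add: zero_wd_def plus_wd_def)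
end

type_synonym 'a free_elem = "'a wd \<Rightarrow>\<^sub>0 complex"

definition scalar :: "complex \<Rightarrow> 'a free_elem" where
  "scalar c = Poly_Mapping.single 0 c"

definition gen :: "'a \<Rightarrow> 'a free_elem" where
  "gen x = Poly_Mapping.single (Wd [x]) 1"

text \<open>The free associative unital \<open>\<complex>\<close>-algebra on the set \<open>A\<close>.\<close>

definition free_algebra :: "'a set \<Rightarrow> 'a free_elem ring" where
  "free_algebra A =
     \<lparr>carrier = {f. \<forall>w \<in> Poly_Mapping.keys f. set (letters w) \<subseteq> A},
      monoid.mult = (*), one = 1, zero = 0, add = (+)\<rparr>"

text \<open>In the following \<open>\<gg>\<close> is (the carrier of) a Lie subalgebra of an ambient Lie algebra. Modulo
  the first two families of relations the free algebra on the set \<open>\<gg>\<close> is the tensor algebra of the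
  vector space \<open>\<gg>\<close>.\<close>

definition uea_relations ::
  "(complex \<Rightarrow> 'g \<Rightarrow> 'g) \<Rightarrow> ('g \<Rightarrow> 'g \<Rightarrow> 'g) \<Rightarrow> 'g::ab_group_add set \<Rightarrow> 'g free_elem set" where
  "uea_relations scale bracket \<gg> =
     {gen (x + y) - (gen x + gen y) | x y. x \<in> \<gg> \<and> y \<in> \<gg>} \<union>
     {gen (scale c x) - scalar c * gen x | c x. x \<in> \<gg>} \<union>
     {gen x * gen y - gen y * gen x - gen (bracket x y) | x y. x \<in> \<gg> \<and> y \<in> \<gg>}"

definition uea_ideal ::
  "(complex \<Rightarrow> 'g \<Rightarrow> 'g) \<Rightarrow> ('g \<Rightarrow> 'g \<Rightarrow> 'g) \<Rightarrow> 'g::ab_group_add set \<Rightarrow> 'g free_elem set" where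
  "uea_ideal scale bracket \<gg> = Idl\<^bsub>free_algebra \<gg>\<^esub> (uea_relations scale bracket \<gg>)"

definition uea ::
  "(complex \<Rightarrow> 'g \<Rightarrow> 'g) \<Rightarrow> ('g \<Rightarrow> 'g \<Rightarrow> 'g) \<Rightarrow> 'g::ab_group_add set \<Rightarrow> 'g free_elem set ring" where
  "uea scale bracket \<gg> = free_algebra \<gg> Quot uea_ideal scale bracket \<gg>"

definition uea_class ::
  "(complex \<Rightarrow> 'g \<Rightarrow> 'g) \<Rightarrow> ('g \<Rightarrow> 'g \<Rightarrow> 'g) \<Rightarrow> 'g::ab_group_add set \<Rightarrow> 'g free_elem \<Rightarrow> 'g free_elem set"
  where "uea_class scale bracket \<gg> f = uea_ideal scale bracket \<gg> +>\<^bsub>free_algebra \<gg>\<^esub> f"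

text \<open>For a subalgebra \<open>\<hh> \<subseteq> \<gg>\<close>, the homomorphism \<open>U(\<hh>) \<rightarrow> U(\<gg>)\<close> induced by the inclusion: it sends
  the coset of \<open>f\<close> modulo the smaller ideal to the coset of \<open>f\<close> modulo the larger one, which is the
  sum of the former and the larger ideal.\<close>

definition uea_inclusion ::
  "(complex \<Rightarrow> 'g \<Rightarrow> 'g) \<Rightarrow> ('g \<Rightarrow> 'g \<Rightarrow> 'g) \<Rightarrow> 'g::ab_group_add set \<Rightarrow> 'g free_elem set \<Rightarrow> 'g free_elem set"
  where "uea_inclusion scale bracket \<gg> u = uea_ideal scale bracket \<gg> <+>\<^bsub>free_algebra \<gg>\<^esub> u"


section \<open>Lie algebra modules\<close>

text \<open>A complex vector space (encoded as in \<^typ>\<open>(complex, 'm) module\<close>) with an operation of \<^typ>\<open>'g\<close>.\<close>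

record ('g, 'm) lie_module = "(complex, 'm) module" +
  act :: "'g \<Rightarrow> 'm \<Rightarrow> 'm"

text \<open>The \<open>\<gg>\<close>-module underlying a \<open>U(\<gg>)\<close>-module.\<close>

definition lie_module_of ::
  "(complex \<Rightarrow> 'g \<Rightarrow> 'g) \<Rightarrow> ('g \<Rightarrow> 'g \<Rightarrow> 'g) \<Rightarrow> 'g::ab_group_add set \<Rightarrow>
   ('g free_elem set, 'm) module \<Rightarrow> ('g, 'm) lie_module" where
  "lie_module_of scale bracket \<gg> M =
     \<lparr>carrier = carrier M, monoid.mult = monoid.mult M, one = one M, zero = zero M, add = add M,
      module.smult = (\<lambda>c v. uea_class scale bracket \<gg> (scalar c) \<odot>\<^bsub>M\<^esub> v),
      act = (\<lambda>x v. uea_class scale bracket \<gg> (gen x) \<odot>\<^bsub>M\<^esub> v)\<rparr>"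

definition lie_module_iso :: "'g set \<Rightarrow> ('g, 'm) lie_module \<Rightarrow> ('g, 'n) lie_module \<Rightarrow> bool" where
  "lie_module_iso \<gg> V W \<longleftrightarrow> (\<exists>\<phi>. bij_betw \<phi> (carrier V) (carrier W) \<and>
     (\<forall>v \<in> carrier V. \<forall>w \<in> carrier V. \<phi> (v \<oplus>\<^bsub>V\<^esub> w) = \<phi> v \<oplus>\<^bsub>W\<^esub> \<phi> w) \<and>
     (\<forall>c. \<forall>v \<in> carrier V. \<phi> (c \<odot>\<^bsub>V\<^esub> v) = c \<odot>\<^bsub>W\<^esub> \<phi> v) \<and>
     (\<forall>x \<in> \<gg>. \<forall>v \<in> carrier V. \<phi> (act V x v) = act W x (\<phi> v)))"


section \<open>The Heisenberg-Virasoro algebra\<close>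

datatype hv_basis = L int | I int | C1 | C2 | C3

type_synonym hv = "hv_basis \<Rightarrow>\<^sub>0 complex"

definition hv_scale :: "complex \<Rightarrow> hv \<Rightarrow> hv" where
  "hv_scale c x = Poly_Mapping.map ((*) c) x"

fun hv_bracket_basis :: "hv_basis \<Rightarrow> hv_basis \<Rightarrow> hv" where
  "hv_bracket_basis (L m) (L n) = Poly_Mapping.single (L (m + n)) (of_int (n - m)) +
     (if m + n = 0 then Poly_Mapping.single C1 (of_int (m ^ 3 - m) / 12) else 0)"
| "hv_bracket_basis (L m) (I n) = Poly_Mapping.single (I (m + n)) (of_int n) +
     (if m + n = 0 then Poly_Mapping.single C2 (of_int (m ^ 2 + m)) else 0)"
| "hv_bracket_basis (I n) (L m) = - (Poly_Mapping.single (I (m + n)) (of_int n) +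
     (if m + n = 0 then Poly_Mapping.single C2 (of_int (m ^ 2 + m)) else 0))"
| "hv_bracket_basis (I m) (I n) =
     (if m + n = 0 then Poly_Mapping.single C3 (of_int m) else 0)"
| "hv_bracket_basis _ _ = 0"

definition hv_bracket :: "hv \<Rightarrow> hv \<Rightarrow> hv" where
  "hv_bracket x y = (\<Sum>a \<in> Poly_Mapping.keys x. \<Sum>b \<in> Poly_Mapping.keys y.
     hv_scale (Poly_Mapping.lookup x a * Poly_Mapping.lookup y b) (hv_bracket_basis a b))"

abbreviation U_hv :: "hv free_elem set ring" where
  "U_hv \<equiv> uea hv_scale hv_bracket UNIV"

definition CL0 :: "hv set" where
  "CL0 = {hv_scale c (Poly_Mapping.single (L 0) 1) | c. True}"

abbreviation U_CL0 :: "hv free_elem set ring" where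
  "U_CL0 \<equiv> uea hv_scale hv_bracket CL0"

abbreviation restrict_to_U_CL0 ::
  "(hv free_elem set, 'm) module \<Rightarrow> (hv free_elem set, 'm) module" where
  "restrict_to_U_CL0 \<equiv> restrict_scalars (uea_inclusion hv_scale hv_bracket UNIV)"

text \<open>Below, \<open>f \<circ>\<^sub>p [:-m, 1:]\<close> is \<open>f(t - m)\<close> and \<open>[:-m\<alpha>, 1:]\<close> is \<open>t - m\<alpha>\<close>.\<close>

fun Omega_basis :: "complex \<Rightarrow> complex \<Rightarrow> complex \<Rightarrow> hv_basis \<Rightarrow> complex poly \<Rightarrow> complex poly" where
  "Omega_basis lam \<alpha> \<beta> (L m) f =
     Polynomial.smult (lam powi m) ([:- (of_int m * \<alpha>), 1:] * (f \<circ>\<^sub>p [:- of_int m, 1:]))"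
| "Omega_basis lam \<alpha> \<beta> (I m) f = Polynomial.smult (\<beta> * lam powi m) (f \<circ>\<^sub>p [:- of_int m, 1:])"
| "Omega_basis lam \<alpha> \<beta> _ f = 0"

definition Omega_act :: "complex \<Rightarrow> complex \<Rightarrow> complex \<Rightarrow> hv \<Rightarrow> complex poly \<Rightarrow> complex poly" where
  "Omega_act lam \<alpha> \<beta> x f = (\<Sum>a \<in> Poly_Mapping.keys x.
     Polynomial.smult (Poly_Mapping.lookup x a) (Omega_basis lam \<alpha> \<beta> a f))"

definition Omega :: "complex \<Rightarrow> complex \<Rightarrow> complex \<Rightarrow> (hv, complex poly) lie_module" where
  "Omega lam \<alpha> \<beta> = \<lparr>carrier = UNIV, monoid.mult = (*), one = 1, zero = 0, add = (+),
     module.smult = Polynomial.smult, act = Omega_act lam \<alpha> \<beta>\<rparr>"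

abbreviation iso_Omega ::
  "(hv free_elem set, 'm) module \<Rightarrow> complex \<Rightarrow> complex \<Rightarrow> complex \<Rightarrow> bool" where
  "iso_Omega M lam \<alpha> \<beta> \<equiv>
     lie_module_iso UNIV (lie_module_of hv_scale hv_bracket UNIV M) (Omega lam \<alpha> \<beta>)"


section \<open>The definitions are coherent\<close>

text \<open>\<^const>\<open>uea\<close> is a ring and \<^const>\<open>uea_inclusion\<close> maps the class of \<open>f\<close> to the class of \<open>f\<close>; the
  Heisenberg-Virasoro algebra is a Lie algebra; \<^const>\<open>Omega_act\<close> respects its bracket.\<close>

lemma free_algebra_simps [simp]:
  "\<one>\<^bsub>free_algebra A\<^esub> = 1" "\<zero>\<^bsub>free_algebra A\<^esub> = 0"
  "x \<otimes>\<^bsub>free_algebra A\<^esub> y = x * y" "x \<oplus>\<^bsub>free_algebra A\<^esub> y = x + y"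
  by (simp_all add: free_algebra_def)

lemma free_algebra_carrier:
  "f \<in> carrier (free_algebra A) \<longleftrightarrow> (\<forall>w \<in> Poly_Mapping.keys f. set (letters w) \<subseteq> A)"
  by (simp add: free_algebra_def)

lemma free_algebra_closed:
  "f \<in> carrier (free_algebra A) \<Longrightarrow> h \<in> carrier (free_algebra A) \<Longrightarrow> f + h \<in> carrier (free_algebra A)"
  "f \<in> carrier (free_algebra A) \<Longrightarrow> h \<in> carrier (free_algebra A) \<Longrightarrow> f - h \<in> carrier (free_algebra A)"
  "f \<in> carrier (free_algebra A) \<Longrightarrow> h \<in> carrier (free_algebra A) \<Longrightarrow> f * h \<in> carrier (free_algebra A)"
  "f \<in> carrier (free_algebra A) \<Longrightarrow> - f \<in> carrier (free_algebra A)"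
  "scalar c \<in> carrier (free_algebra A)"
  "x \<in> A \<Longrightarrow> gen x \<in> carrier (free_algebra A)"
  using Poly_Mapping.keys_add[of f h] Poly_Mapping.keys_diff[of f h] keys_mult[of f h]
  by (fastforce simp: free_algebra_carrier scalar_def gen_def zero_wd_def plus_wd_def)+

lemma ring_free_algebra: "ring (free_algebra A)"
proof (rule ringI)
  show "abelian_group (free_algebra A)"
  proof (rule abelian_groupI)
    fix x assume "x \<in> carrier (free_algebra A)"
    then show "\<exists>y\<in>carrier (free_algebra A). y \<oplus>\<^bsub>free_algebra A\<^esub> x = \<zero>\<^bsub>free_algebra A\<^esub>"
      by (intro bexI[of _ "-x"]) (auto simp: free_algebra_closed)
  qed (auto simp: free_algebra_closed add.assoc add.commute, auto simp: free_algebra_carrier)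
  show "monoid (free_algebra A)"
    by (rule monoidI) (auto simp: free_algebra_closed mult.assoc, auto simp: free_algebra_carrier zero_wd_def)
qed (auto simp: algebra_simps)

lemma ideal_uea_ideal:
  assumes "\<And>x y. x \<in> \<gg> \<Longrightarrow> y \<in> \<gg> \<Longrightarrow> x + y \<in> \<gg>" "\<And>c x. x \<in> \<gg> \<Longrightarrow> scale c x \<in> \<gg>"
    "\<And>x y. x \<in> \<gg> \<Longrightarrow> y \<in> \<gg> \<Longrightarrow> bracket x y \<in> \<gg>"
  shows "ideal (uea_ideal scale bracket \<gg>) (free_algebra \<gg>)"
  unfolding uea_ideal_def
  by (rule ring.genideal_ideal[OF ring_free_algebra])
     (auto simp: uea_relations_def intro!: free_algebra_closed assms)

lemma ring_uea:
  assumes "\<And>x y. x \<in> \<gg> \<Longrightarrow> y \<in> \<gg> \<Longrightarrow> x + y \<in> \<gg>" "\<And>c x. x \<in> \<gg> \<Longrightarrow> scale c x \<in> \<gg>"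
    "\<And>x y. x \<in> \<gg> \<Longrightarrow> y \<in> \<gg> \<Longrightarrow> bracket x y \<in> \<gg>"
  shows "ring (uea scale bracket \<gg>)"
  unfolding uea_def by (rule ideal.quotient_is_ring[OF ideal_uea_ideal[OF assms]])

lemma lookup_hv_scale [simp]: "Poly_Mapping.lookup (hv_scale c x) a = c * Poly_Mapping.lookup x a"
  by (simp add: hv_scale_def Poly_Mapping.map.rep_eq when_def)

lemma vector_space_hv: "vector_space hv_scale"
  by standard (auto intro!: poly_mapping_eqI simp: lookup_add algebra_simps)

interpretation hv: vector_space hv_scale by (rule vector_space_hv)

lemma hv_bracket_superset:
  assumes "finite A" "finite B" "Poly_Mapping.keys x \<subseteq> A" "Poly_Mapping.keys y \<subseteq> B"
  shows "hv_bracket x y = (\<Sum>a \<in> A. \<Sum>b \<in> B.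
     hv_scale (Poly_Mapping.lookup x a * Poly_Mapping.lookup y b) (hv_bracket_basis a b))"
proof -
  have "hv_bracket x y = (\<Sum>a \<in> Poly_Mapping.keys x. \<Sum>b \<in> B.
     hv_scale (Poly_Mapping.lookup x a * Poly_Mapping.lookup y b) (hv_bracket_basis a b))"
    unfolding hv_bracket_def
    by (intro sum.cong refl sum.mono_neutral_left) (use assms in \<open>auto simp: in_keys_iff\<close>)
  also have "\<dots> = (\<Sum>a \<in> A. \<Sum>b \<in> B.
     hv_scale (Poly_Mapping.lookup x a * Poly_Mapping.lookup y b) (hv_bracket_basis a b))"
    by (intro sum.mono_neutral_left) (use assms in \<open>auto simp: in_keys_iff\<close>)
  finally show ?thesis .
qed

lemma hv_bracket_add_left: "hv_bracket (x + y) z = hv_bracket x z + hv_bracket y z"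
proof -
  let ?A = "Poly_Mapping.keys x \<union> Poly_Mapping.keys y"
  show ?thesis
    by (subst (1 2 3) hv_bracket_superset[where A = ?A and B = "Poly_Mapping.keys z"])
      (use Poly_Mapping.keys_add[of x y] in
        \<open>auto simp: lookup_add algebra_simps hv.scale_left_distrib sum.distrib\<close>)
qed

lemma hv_bracket_add_right: "hv_bracket z (x + y) = hv_bracket z x + hv_bracket z y"
proof -
  let ?A = "Poly_Mapping.keys x \<union> Poly_Mapping.keys y"
  show ?thesis
    by (subst (1 2 3) hv_bracket_superset[where B = ?A and A = "Poly_Mapping.keys z"])
      (use Poly_Mapping.keys_add[of x y] in
        \<open>auto simp: lookup_add algebra_simps hv.scale_left_distrib sum.distrib\<close>)
qed

lemma keys_hv_scale: "Poly_Mapping.keys (hv_scale c x) \<subseteq> Poly_Mapping.keys x"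
  by (auto simp: in_keys_iff)

lemma hv_bracket_scale_left: "hv_bracket (hv_scale c x) y = hv_scale c (hv_bracket x y)"
  by (subst (1 2) hv_bracket_superset[where A = "Poly_Mapping.keys x" and B = "Poly_Mapping.keys y"])
    (use keys_hv_scale in \<open>auto simp: hv.scale_sum_right mult.assoc\<close>)

lemma hv_bracket_scale_right: "hv_bracket x (hv_scale c y) = hv_scale c (hv_bracket x y)"
  by (subst (1 2) hv_bracket_superset[where A = "Poly_Mapping.keys x" and B = "Poly_Mapping.keys y"])
    (use keys_hv_scale in \<open>auto simp: hv.scale_sum_right mult.assoc mult.left_commute\<close>)

lemma hv_bracket_single:
  "hv_bracket (Poly_Mapping.single a c) (Poly_Mapping.single b d) = hv_scale (c * d) (hv_bracket_basis a b)"
  by (subst hv_bracket_superset[where A = "{a}" and B = "{b}"]) auto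

lemma hv_bracket_0 [simp]: "hv_bracket 0 x = 0" "hv_bracket x 0 = 0"
  by (auto simp: hv_bracket_def)

lemma hv_bracket_minus_left: "hv_bracket (- x) y = - hv_bracket x y"
  using hv_bracket_add_left[of x "-x" y] by (simp add: eq_neg_iff_add_eq_0 add.commute)
lemma hv_bracket_minus_right: "hv_bracket y (- x) = - hv_bracket y x"
  using hv_bracket_add_right[of y x "-x"] by (simp add: eq_neg_iff_add_eq_0 add.commute)

lemma hv_bracket_diff_right: "hv_bracket y (x - z) = hv_bracket y x - hv_bracket y z"
  using hv_bracket_add_right[of y x "-z"] by (simp add: hv_bracket_minus_right)

lemma hv_bracket_basis_anti: "hv_bracket_basis b a = - hv_bracket_basis a b"
proof -
  have LL: "hv_bracket_basis (L n) (L m) = - hv_bracket_basis (L m) (L n)" for m n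
  proof (cases "m + n = 0")
    case True
    then have n: "n = - m" by simp
    show ?thesis unfolding n
      by (rule poly_mapping_eqI)
        (simp add: lookup_add lookup_minus lookup_single when_def power3_eq_cube diff_divide_distrib)
  qed (auto intro!: poly_mapping_eqI simp: lookup_single when_def add.commute)
  have II: "hv_bracket_basis (I n) (I m) = - hv_bracket_basis (I m) (I n)" for m n
  proof (cases "m + n = 0")
    case True
    then have n: "n = - m" by simp
    show ?thesis unfolding n by (simp add: Poly_Mapping.single_uminus)
  qed (simp add: add.commute)
  show ?thesis
    by (cases a; cases b; (simp only:, rule LL II)?)
      (simp_all only: hv_bracket_basis.simps minus_zero minus_minus)
qed

lemma hv_bracket_anti: "hv_bracket y x = - hv_bracket x y"
proof -
  have "hv_bracket y x = (\<Sum>a \<in> Poly_Mapping.keys x. \<Sum>b \<in> Poly_Mapping.keys y.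
      hv_scale (Poly_Mapping.lookup y b * Poly_Mapping.lookup x a) (hv_bracket_basis b a))"
    unfolding hv_bracket_def by (rule sum.swap)
  also have "\<dots> = (\<Sum>a \<in> Poly_Mapping.keys x. \<Sum>b \<in> Poly_Mapping.keys y.
      - hv_scale (Poly_Mapping.lookup x a * Poly_Mapping.lookup y b) (hv_bracket_basis a b))"
    by (intro sum.cong refl) (metis hv_bracket_basis_anti hv.scale_minus_right mult.commute)
  finally show ?thesis by (simp add: hv_bracket_def sum_negf)
qed

lemma hv_single_scale: "Poly_Mapping.single a c = hv_scale c (Poly_Mapping.single a 1)"
  by (auto intro!: poly_mapping_eqI simp: lookup_single when_def)

lemma hv_scale_single [simp]: "hv_scale c (Poly_Mapping.single a d) = Poly_Mapping.single a (c * d)"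
  by (auto intro!: poly_mapping_eqI simp: lookup_single when_def)

lemma hv_jacobi_basis:
  fixes a b d :: hv_basis
  defines "e \<equiv> \<lambda>a. Poly_Mapping.single a 1 :: hv"
  shows "hv_bracket (e a) (hv_bracket (e b) (e d)) + hv_bracket (e b) (hv_bracket (e d) (e a))
    + hv_bracket (e d) (hv_bracket (e a) (e b)) = 0"
proof -
  define J where "J a b d = hv_bracket (e a) (hv_bracket (e b) (e d)) +
    hv_bracket (e b) (hv_bracket (e d) (e a)) + hv_bracket (e d) (hv_bracket (e a) (e b))" for a b d
  have cyc: "J a b d = J b d a" for a b d by (simp add: J_def algebra_simps)
  note simps = J_def e_def hv_bracket_single hv_bracket_add_right hv_bracket_minus_right
    hv_bracket_diff_right lookup_minus
    Poly_Mapping.single_add[symmetric] Poly_Mapping.single_uminus[symmetric] lookup_add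
    lookup_single when_def
  have LLL: "J (L m) (L n) (L k) = 0" for m n k
  proof (cases "k = - m - n")
    case True
    show ?thesis unfolding True
      by (rule poly_mapping_eqI) (auto simp: simps field_simps power3_eq_cube)
  next
    case False
    then show ?thesis
      by (intro poly_mapping_eqI) (auto simp: simps algebra_simps)
  qed
  have LLI: "J (L m) (L n) (I k) = 0" for m n k
  proof (cases "k = - m - n")
    case True
    show ?thesis unfolding True
      by (rule poly_mapping_eqI) (auto simp: simps field_simps power2_eq_square)
  next
    case False
    then show ?thesis
      by (intro poly_mapping_eqI) (auto simp: simps algebra_simps)
  qed
  have LII: "J (L m) (I n) (I k) = 0" for m n k
    by (intro poly_mapping_eqI) (auto simp: simps algebra_simps add_eq_0_iff)
  have III: "J (I m) (I n) (I k) = 0" for m n k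
    by (simp add: simps)
  have C: "J c b d = 0" if "c \<in> {C1, C2, C3}" for c b d
    using that by (cases b; cases d) (auto simp: simps)
  have C': "J b c d = 0" "J b d c = 0" if "c \<in> {C1, C2, C3}" for c b d
    using C[OF that] cyc by metis+
  have LIL: "J (L m) (I k) (L n) = 0" "J (I k) (L m) (L n) = 0" for m n k
    using LLI cyc by metis+
  have ILI: "J (I n) (L m) (I k) = 0" "J (I n) (I k) (L m) = 0" for m n k
    using LII cyc by metis+
  have "J a b d = 0"
    by (cases a; cases b; cases d) (simp_all add: C C' LLL LLI LIL LII ILI III)
  then show ?thesis by (simp add: J_def)
qed

lemma pm_induct [case_names single add]:
  fixes f :: "'a \<Rightarrow>\<^sub>0 'b::comm_monoid_add"
  assumes single: "\<And>a c. P (Poly_Mapping.single a c)" and add: "\<And>f g. P f \<Longrightarrow> P g \<Longrightarrow> P (f + g)"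
  shows "P f"
proof (induction f rule: update_induct)
  case const
  show ?case using single[of undefined 0] by simp
next
  case (update f a b)
  have "Poly_Mapping.update a b f = f + Poly_Mapping.single a b"
    using update(1) by (auto intro!: poly_mapping_eqI simp: lookup_update lookup_add lookup_single when_def in_keys_iff)
  then show ?case using update single add by simp
qed

lemma lie_algebra_hv: "lie_algebra hv_scale hv_bracket"
proof (intro lie_algebra.intro lie_algebra_axioms.intro vector_space_hv)
  fix x y z :: hv
  show "hv_bracket x x = 0"
  proof (rule poly_mapping_eqI)
    fix a
    have "Poly_Mapping.lookup (hv_bracket x x) a = - Poly_Mapping.lookup (hv_bracket x x) a"
      by (metis hv_bracket_anti lookup_uminus)
    then show "Poly_Mapping.lookup (hv_bracket x x) a = Poly_Mapping.lookup 0 a" by simp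
  qed

  define J where "J x y z = hv_bracket x (hv_bracket y z) + hv_bracket y (hv_bracket z x)
    + hv_bracket z (hv_bracket x y)" for x y z
  have add: "J (x + x') y z = J x y z + J x' y z" "J x (y + y') z = J x y z + J x y' z"
    "J x y (z + z') = J x y z + J x y z'" for x x' y y' z z'
    by (simp_all add: J_def hv_bracket_add_left hv_bracket_add_right algebra_simps)
  have scale: "J (hv_scale c x) (hv_scale d y) (hv_scale k z) = hv_scale (c * d * k) (J x y z)" for c d k x y z
    by (simp add: J_def hv_bracket_scale_left hv_bracket_scale_right hv.scale_right_distrib mult_ac)
  have single: "J (Poly_Mapping.single a c) (Poly_Mapping.single b d) (Poly_Mapping.single k f) = 0" for a b k c d f
  proof -
    have "J (Poly_Mapping.single a 1) (Poly_Mapping.single b 1) (Poly_Mapping.single k 1) = 0"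
      unfolding J_def by (rule hv_jacobi_basis)
    then show ?thesis
      using scale[of c "Poly_Mapping.single a 1" d "Poly_Mapping.single b 1" f "Poly_Mapping.single k 1"]
      by simp
  qed
  have "J (Poly_Mapping.single a c) (Poly_Mapping.single b d) z = 0" for a b c d z
    by (induction z rule: pm_induct) (simp_all add: single add)
  then have "J (Poly_Mapping.single a c) y z = 0" for a c y z
    by (induction y rule: pm_induct) (simp_all add: add)
  then have "J x y z = 0"
    by (induction x rule: pm_induct) (simp_all add: add)
  then show "hv_bracket x (hv_bracket y z) + hv_bracket y (hv_bracket z x) + hv_bracket z (hv_bracket x y) = 0"
    by (simp add: J_def)
qed (simp_all add: hv_bracket_add_left hv_bracket_add_right hv_bracket_scale_left hv_bracket_scale_right)

lemma pm_smult_sum: "Polynomial.smult c (sum f A) = (\<Sum>a\<in>A. Polynomial.smult c (f a))"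
  by (induction A rule: infinite_finite_induct) (auto simp: smult_add_right)

lemma Omega_act_superset:
  assumes "finite A" "Poly_Mapping.keys x \<subseteq> A"
  shows "Omega_act lam \<alpha> \<beta> x f =
    (\<Sum>a\<in>A. Polynomial.smult (Poly_Mapping.lookup x a) (Omega_basis lam \<alpha> \<beta> a f))"
  unfolding Omega_act_def
  by (intro sum.mono_neutral_left) (use assms in \<open>auto simp: in_keys_iff\<close>)

lemma Omega_act_add: "Omega_act lam \<alpha> \<beta> (x + y) f = Omega_act lam \<alpha> \<beta> x f + Omega_act lam \<alpha> \<beta> y f"
proof -
  let ?A = "Poly_Mapping.keys x \<union> Poly_Mapping.keys y"
  show ?thesis
    by (subst (1 2 3) Omega_act_superset[where A = ?A])
      (use Poly_Mapping.keys_add[of x y] in \<open>auto simp: lookup_add smult_add_left sum.distrib\<close>)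
qed

lemma Omega_act_scale: "Omega_act lam \<alpha> \<beta> (hv_scale c x) f = Polynomial.smult c (Omega_act lam \<alpha> \<beta> x f)"
  by (subst (1 2) Omega_act_superset[where A = "Poly_Mapping.keys x"])
    (use keys_hv_scale in \<open>auto simp: pm_smult_sum mult.assoc\<close>)

lemma Omega_act_single [simp]:
  "Omega_act lam \<alpha> \<beta> (Poly_Mapping.single a c) f = Polynomial.smult c (Omega_basis lam \<alpha> \<beta> a f)"
  by (subst Omega_act_superset[where A = "{a}"]) auto

lemma Omega_basis_lin:
  "Omega_basis lam \<alpha> \<beta> a (f + g) = Omega_basis lam \<alpha> \<beta> a f + Omega_basis lam \<alpha> \<beta> a g"
  "Omega_basis lam \<alpha> \<beta> a (Polynomial.smult c f) = Polynomial.smult c (Omega_basis lam \<alpha> \<beta> a f)"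
  by (cases a; simp add: pcompose_add smult_add_right distrib_left)
    (cases a; simp add: pcompose_smult mult_ac)

lemma Omega_act_lin:
  "Omega_act lam \<alpha> \<beta> x (f + g) = Omega_act lam \<alpha> \<beta> x f + Omega_act lam \<alpha> \<beta> x g"
  "Omega_act lam \<alpha> \<beta> x (Polynomial.smult c f) = Polynomial.smult c (Omega_act lam \<alpha> \<beta> x f)"
  by (simp_all add: Omega_act_def Omega_basis_lin smult_add_right sum.distrib pm_smult_sum mult.commute)

lemma Omega_basis_bracket:
  assumes "lam \<noteq> 0"
  shows "Omega_act lam \<alpha> \<beta> (hv_bracket_basis a b) f =
    Omega_basis lam \<alpha> \<beta> a (Omega_basis lam \<alpha> \<beta> b f) - Omega_basis lam \<alpha> \<beta> b (Omega_basis lam \<alpha> \<beta> a f)"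
proof -
  have *: "Omega_act lam \<alpha> \<beta> (- x) f = - Omega_act lam \<alpha> \<beta> x f"  "Omega_act lam \<alpha> \<beta> 0 f = 0" for x
    using Omega_act_add[of lam \<alpha> \<beta> x "-x"] by (auto simp: Omega_act_def eq_neg_iff_add_eq_0 add.commute)
  have **: "Omega_act lam \<alpha> \<beta> (x - y) f = Omega_act lam \<alpha> \<beta> x f - Omega_act lam \<alpha> \<beta> y f" for x y
    using Omega_act_add[of lam \<alpha> \<beta> x "-y"] by (simp add: *)
  have "poly (Omega_act lam \<alpha> \<beta> (hv_bracket_basis a b) f) t =
      poly (Omega_basis lam \<alpha> \<beta> a (Omega_basis lam \<alpha> \<beta> b f)) t -
      poly (Omega_basis lam \<alpha> \<beta> b (Omega_basis lam \<alpha> \<beta> a f)) t" for t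
    by (cases a; cases b)
      (simp_all add: * ** Omega_act_add poly_pcompose power_int_add[OF disjI1[OF assms]] algebra_simps)
  then show ?thesis
    by (intro poly_eq_poly_eq_iff[THEN iffD1] ext) simp
qed

lemma Omega_act_bracket:
  assumes "lam \<noteq> 0"
  shows "Omega_act lam \<alpha> \<beta> (hv_bracket x y) f =
    Omega_act lam \<alpha> \<beta> x (Omega_act lam \<alpha> \<beta> y f) - Omega_act lam \<alpha> \<beta> y (Omega_act lam \<alpha> \<beta> x f)"
proof (induction x rule: pm_induct)
  case (single a c)
  show ?case
  proof (induction y rule: pm_induct)
    case (single b d)
    show ?case
      by (simp add: hv_bracket_single Omega_act_scale Omega_basis_bracket[OF assms] Omega_basis_lin smult_diff_right mult.commute)
  next
    case (add y z)
    then show ?case by (simp add: hv_bracket_add_right Omega_act_add Omega_act_lin Omega_basis_lin smult_add_right)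
  qed
next
  case (add y z)
  then show ?case by (simp add: hv_bracket_add_left Omega_act_add Omega_act_lin)
qed

lemma uea_ideal_mono:
  assumes "\<hh> \<subseteq> \<gg>" and g: "ideal (uea_ideal s b \<gg>) (free_algebra \<gg>)"
    and rel: "uea_relations s b \<hh> \<subseteq> carrier (free_algebra \<hh>)" "uea_relations s b \<gg> \<subseteq> carrier (free_algebra \<gg>)"
  shows "uea_ideal s b \<hh> \<subseteq> uea_ideal s b \<gg>"
proof -
  interpret F: ring "free_algebra \<hh>" by (rule ring_free_algebra)
  interpret G: ring "free_algebra \<gg>" by (rule ring_free_algebra)
  interpret I: ideal "uea_ideal s b \<gg>" "free_algebra \<gg>" by (rule g)
  have car: "carrier (free_algebra \<hh>) \<subseteq> carrier (free_algebra \<gg>)"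
    using assms(1) by (fastforce simp: free_algebra_carrier)
  let ?K = "uea_ideal s b \<gg> \<inter> carrier (free_algebra \<hh>)"
  have minus: "\<ominus>\<^bsub>free_algebra \<hh>\<^esub> x = - x" if "x \<in> carrier (free_algebra \<hh>)" for x
    using that F.minus_equality[of "-x" x] by (simp add: free_algebra_closed)
  have minus': "\<ominus>\<^bsub>free_algebra \<gg>\<^esub> x = - x" if "x \<in> carrier (free_algebra \<gg>)" for x
    using that G.minus_equality[of "-x" x] by (simp add: free_algebra_closed)
  have "ideal ?K (free_algebra \<hh>)"
  proof (rule idealI)
    show "subgroup ?K (add_monoid (free_algebra \<hh>))"
    proof (rule F.add.subgroupI)
      fix a assume "a \<in> ?K"
      then show "\<ominus>\<^bsub>free_algebra \<hh>\<^esub> a \<in> ?K"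
        using I.a_inv_closed[of a] minus[of a] minus'[of a] car by (auto simp: free_algebra_closed)
    next
      fix a c assume "a \<in> ?K" "c \<in> ?K"
      then show "a \<oplus>\<^bsub>free_algebra \<hh>\<^esub> c \<in> ?K"
        using I.a_closed[of a c] by (auto simp: free_algebra_closed)
    qed (use I.zero_closed F.zero_closed in auto)
  qed (use I.I_l_closed I.I_r_closed car F.ring_axioms in \<open>auto simp: free_algebra_closed\<close>)
  moreover have "uea_relations s b \<hh> \<subseteq> ?K"
  proof -
    have "uea_relations s b \<hh> \<subseteq> uea_relations s b \<gg>"
      unfolding uea_relations_def by (intro Un_mono) (use assms(1) in blast)+
    also have "\<dots> \<subseteq> uea_ideal s b \<gg>"
      unfolding uea_ideal_def by (rule G.genideal_self[OF rel(2)])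
    finally show ?thesis using rel(1) by blast
  qed
  ultimately show ?thesis
    unfolding uea_ideal_def[of s b \<hh>] using F.genideal_minimal by blast
qed

lemma uea_inclusion_class:
  assumes "\<hh> \<subseteq> \<gg>" and g: "ideal (uea_ideal s b \<gg>) (free_algebra \<gg>)" "ideal (uea_ideal s b \<hh>) (free_algebra \<hh>)"
    and rel: "uea_relations s b \<hh> \<subseteq> carrier (free_algebra \<hh>)" "uea_relations s b \<gg> \<subseteq> carrier (free_algebra \<gg>)"
  shows "uea_inclusion s b \<gg> (uea_class s b \<hh> f) = uea_class s b \<gg> f"
proof -
  have "0 \<in> uea_ideal s b \<hh>"
    using additive_subgroup.zero_closed[OF ideal.axioms(1)[OF g(2)]] by simp
  moreover have "x + y \<in> uea_ideal s b \<gg>" if "x \<in> uea_ideal s b \<gg>" "y \<in> uea_ideal s b \<hh>" for x y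
    using additive_subgroup.a_closed[OF ideal.axioms(1)[OF g(1)], of x y] that
      uea_ideal_mono[OF assms(1) g(1) rel] by auto
  ultimately have "(\<Union>x \<in> uea_ideal s b \<gg>. \<Union>y \<in> uea_ideal s b \<hh>. {x + (y + f)}) =
      (\<Union>x \<in> uea_ideal s b \<gg>. {x + f})"
    by (auto simp: add.assoc[symmetric])
  then show ?thesis
    by (simp add: uea_inclusion_def uea_class_def a_r_coset_def' set_add_def')
qed

lemma CL0_closed:
  "x \<in> CL0 \<Longrightarrow> y \<in> CL0 \<Longrightarrow> x + y \<in> CL0"
  "x \<in> CL0 \<Longrightarrow> hv_scale c x \<in> CL0"
  "x \<in> CL0 \<Longrightarrow> y \<in> CL0 \<Longrightarrow> hv_bracket x y \<in> CL0"
proof -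
  have 0: "0 \<in> CL0"
    unfolding CL0_def using hv.scale_zero_left by (metis (mono_tags, lifting) mem_Collect_eq)
  show "x \<in> CL0 \<Longrightarrow> y \<in> CL0 \<Longrightarrow> x + y \<in> CL0"
    unfolding CL0_def using hv.scale_left_distrib by (smt (verit) mem_Collect_eq)
  show "x \<in> CL0 \<Longrightarrow> hv_scale c x \<in> CL0"
    unfolding CL0_def using hv.scale_scale by (smt (verit) mem_Collect_eq)
  show "hv_bracket x y \<in> CL0" if "x \<in> CL0" "y \<in> CL0"
  proof -
    have "hv_bracket x y = 0" using that by (auto simp: CL0_def hv_bracket_single)
    with 0 show ?thesis by simp
  qed
qed

lemma ring_U_hv: "ring U_hv"
  by (rule ring_uea) simp_all

lemma ring_U_CL0: "ring U_CL0"
  by (rule ring_uea) (rule CL0_closed; assumption)+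

lemma uea_inclusion_CL0_class:
  "uea_inclusion hv_scale hv_bracket UNIV (uea_class hv_scale hv_bracket CL0 f) =
    uea_class hv_scale hv_bracket UNIV f"
proof (rule uea_inclusion_class)
  show "ideal (uea_ideal hv_scale hv_bracket UNIV) (free_algebra UNIV)"
    by (rule ideal_uea_ideal) simp_all
  show "ideal (uea_ideal hv_scale hv_bracket CL0) (free_algebra CL0)"
    by (rule ideal_uea_ideal) (rule CL0_closed; assumption)+
qed (auto simp: uea_relations_def intro!: free_algebra_closed CL0_closed)

end

theory Submission
  imports Defs "HOL-Computational_Algebra.Fundamental_Theorem_Algebra"
begin

text \<open>A generator \<open>v\<close> of \<open>M\<close> over \<open>U(\<complex>L\<^sub>0)\<close> identifies \<open>M\<close> with \<open>\<complex>[t]\<close>, \<open>L\<^sub>0\<close> acting as multiplication by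
  \<open>t\<close>. Commuting with \<open>L\<^sub>0\<close> forces \<open>L\<^sub>n f = g\<^sub>n(t) f(t - n)\<close> and \<open>I\<^sub>n f = h\<^sub>n(t) f(t - n)\<close>. The bracket
  \<open>[L\<^sub>n, L\<^sub>-\<^sub>n]\<close> shows that \<open>g\<^sub>n(t) g\<^sub>-\<^sub>n(t - n)\<close> has linear \<open>n\<close>-step differences, hence is a monic quadratic; the
  brackets with \<open>L\<^sub>2\<close> and \<open>L\<^sub>-\<^sub>2\<close> then make \<open>g\<^sub>1\<close> and \<open>g\<^sub>-\<^sub>1\<close> linear, and all other \<open>g\<^sub>n\<close> follow. The brackets \<open>[L\<^sub>-\<^sub>n, I\<^sub>n]\<close>
  make every \<open>h\<^sub>n\<close> constant.

  A submodule of \<open>\<Omega>(\<lambda>, \<alpha>, \<beta>)\<close> is an ideal of \<open>\<complex>[t]\<close>. If \<open>r\<close> is a root of its generator \<open>f \<noteq> 0\<close>, then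
  \<open>(r - m\<alpha>) f(r - m) = 0 = \<beta> f(r - m)\<close> for all \<open>m\<close>, so \<open>f\<close> has infinitely many roots unless \<open>\<alpha> = \<beta> = 0\<close>;
  in that case \<open>t\<complex>[t]\<close> is a proper submodule.\<close>

section \<open>Polynomials determined by their finite differences\<close>

lemma poly_eqI_eval:
  fixes p q :: "complex poly"
  assumes "\<And>t. poly p t = poly q t"
  shows "p = q"
  using assms poly_eq_poly_eq_iff by blast

text \<open>Otherwise p(t) - p(0) would be a nonzero polynomial vanishing at all the points n c,
  which are infinitely many.\<close>

lemma periodic_poly_const:
  fixes p :: "complex poly"
  assumes "c \<noteq> 0" "\<And>t. poly p (t + c) = poly p t"
  shows "p = [:poly p 0:]"
proof (rule ccontr)
  assume "p \<noteq> [:poly p 0:]"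
  then have "finite {t. poly (p - [:poly p 0:]) t = 0}"
    by (intro poly_roots_finite) simp
  moreover have "poly p (of_nat n * c) = poly p 0" for n
  proof (induction n)
    case (Suc n)
    then show ?case using assms(2)[of "of_nat n * c"] by (simp add: algebra_simps)
  qed simp
  then have "range (\<lambda>n::nat. of_nat n * c) \<subseteq> {t. poly (p - [:poly p 0:]) t = 0}"
    by auto
  moreover have "infinite (range (\<lambda>n::nat. of_nat n * c))"
    using assms(1) by (intro range_inj_infinite injI) simp
  ultimately show False using finite_subset by blast
qed

text \<open>The quadratic with constant term 0 is a particular solution; two solutions differ by a
  polynomial of period \<open>c\<close>, hence by a constant.\<close>

lemma linear_difference_poly:
  fixes p :: "complex poly"
  assumes "c \<noteq> 0" "\<And>t. poly p (t + c) - poly p t = A * t + B"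
  obtains d where "p = [:d, B / c - A / 2, A / (2 * c):]"
proof -
  define q where "q = p - [:0, B / c - A / 2, A / (2 * c):]"
  have "poly q (t + c) = poly q t" for t
    using assms(2)[of t] assms(1) by (simp add: q_def field_simps)
  from periodic_poly_const[OF assms(1) this] have "p = [:poly q 0:] + [:0, B / c - A / 2, A / (2 * c):]"
    by (simp add: q_def diff_eq_eq)
  then show thesis using that by auto
qed

lemma poly_eq_quadratic:
  assumes "degree p \<le> 2"
  shows "p = [:coeff p 0, coeff p 1, coeff p 2:]"
proof (rule poly_eqI)
  fix n
  show "coeff p n = coeff [:coeff p 0, coeff p 1, coeff p 2:] n"
    using coeff_eq_0[of p n] assms
    by (cases n; cases "n - 1"; cases "n - 2") (auto simp: numeral_2_eq_2)
qed

section \<open>The Virasoro relations\<close>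

text \<open>Here \<open>g n\<close> stands for \<open>L\<^sub>n \<cdot> 1\<close> and \<open>c\<close> for the scalar by which \<open>C\<^sub>1\<close> acts.\<close>

locale virasoro_poly =
  fixes g :: "int \<Rightarrow> complex poly" and c :: complex
  assumes g0: "g 0 = [:0, 1:]"
    and rel: "\<And>m n t. poly (g m) t * poly (g n) (t - of_int m) - poly (g n) t * poly (g m) (t - of_int n) =
      of_int (n - m) * poly (g (m + n)) t + (if m + n = 0 then of_int (m ^ 3 - m) / 12 * c else 0)"
begin

text \<open>The involution \<open>L\<^sub>n \<mapsto> - L\<^sub>-\<^sub>n\<close>, \<open>t \<mapsto> - t\<close>, which transfers results from \<open>n \<ge> 0\<close> to \<open>n \<le> 0\<close>.\<close>

lemma reflect: "virasoro_poly (\<lambda>n. - (g (- n) \<circ>\<^sub>p [:0, -1:])) (- c)"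
proof
  show "- (g (- 0) \<circ>\<^sub>p [:0, -1:]) = [:0, 1:]"
    by (simp add: g0 pcompose_pCons)
next
  fix m n t
  show "poly (- (g (- m) \<circ>\<^sub>p [:0, -1:])) t * poly (- (g (- n) \<circ>\<^sub>p [:0, -1:])) (t - of_int m)
    - poly (- (g (- n) \<circ>\<^sub>p [:0, -1:])) t * poly (- (g (- m) \<circ>\<^sub>p [:0, -1:])) (t - of_int n)
    = of_int (n - m) * poly (- (g (- (m + n)) \<circ>\<^sub>p [:0, -1:])) t
      + (if m + n = 0 then of_int (m ^ 3 - m) / 12 * (- c) else 0)"
    using rel[of "- m" "- t" "- n"] by (auto simp: poly_pcompose algebra_simps)
qed

lemma rel_poly:
  assumes "m + n \<noteq> 0"
  shows "g m * (g n \<circ>\<^sub>p [:- of_int m, 1:]) - g n * (g m \<circ>\<^sub>p [:- of_int n, 1:]) =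
    Polynomial.smult (of_int (n - m)) (g (m + n))"
  by (rule poly_eqI_eval) (use rel[of m _ n] assms in \<open>simp add: poly_pcompose\<close>)

text \<open>With F(t) = g_n(t) g_{-n}(t - n), the second product in the relation for
  \<open>n\<close> and \<open>- n\<close> is F(t + n), so that relation prescribes the differences
  of F.\<close>

lemma product_quadratic:
  assumes "n \<noteq> 0"
  obtains d r where "g n * (g (- n) \<circ>\<^sub>p [:- of_int n, 1:]) = [:d, r, 1:]"
    "r = - of_int n - (of_int n ^ 2 - 1) * c / 12"
proof -
  define F where "F = g n * (g (- n) \<circ>\<^sub>p [:- of_int n, 1:])"
  have "poly F (t + of_int n) - poly F t = (2 * of_int n) * t + - (of_int (n ^ 3 - n) / 12 * c)" for t
    using rel[of n t "- n"] g0 by (simp add: F_def poly_pcompose field_simps)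
  from linear_difference_poly[OF _ this] assms obtain d where
    "F = [:d, - (of_int (n ^ 3 - n) / 12 * c) / of_int n - 2 * of_int n / 2, 2 * of_int n / (2 * of_int n):]"
    by auto
  then show thesis using assms
    by (intro that[of d "- of_int n - (of_int n ^ 2 - 1) * c / 12"])
      (auto simp: F_def field_simps power3_eq_cube power2_eq_square)
qed

text \<open>The product of \<open>product_quadratic\<close> is monic of degree 2, and shifting the
  argument preserves degrees.\<close>

lemma degree_sum:
  assumes "n \<noteq> 0"
  shows "degree (g n) + degree (g (- n)) = 2" and "g n \<noteq> 0"
proof -
  obtain d r where F: "g n * (g (- n) \<circ>\<^sub>p [:- of_int n, 1:]) = [:d, r, 1:]"
    using product_quadratic[OF assms] by metis
  then have nz: "g n \<noteq> 0" "g (- n) \<circ>\<^sub>p [:- of_int n, 1:] \<noteq> 0"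
    by auto
  have "degree [:d, r, 1:] = degree (g n) + degree (g (- n))"
    unfolding F[symmetric] using nz by (simp add: degree_mult_eq degree_pcompose)
  with nz show "degree (g n) + degree (g (- n)) = 2" "g n \<noteq> 0" by simp_all
qed

text \<open>For the subalgebra spanned by \<open>L\<^sub>-\<^sub>1, L\<^sub>0, L\<^sub>1\<close> alone degree 2 does occur; it is the relation
  \<open>[L\<^sub>-\<^sub>1, L\<^sub>2] = 3 L\<^sub>1\<close> that excludes it.\<close>

lemma degree_minus_one: "degree (g (- 1)) \<noteq> 2"
proof
  assume 2: "degree (g (- 1)) = 2"
  then have "degree (g 1) = 0" using degree_sum[of 1] by simp
  then obtain k where k: "g 1 = [:k:]" using degree_eq_zeroE by blast
  obtain a0 a1 a2 where a: "g (- 1) = [:a0, a1, a2:]"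
    using poly_eq_quadratic[of "g (- 1)"] 2 by auto
  then have "a2 \<noteq> 0" using 2 by (auto split: if_splits)
  obtain b0 b1 b2 where b: "g 2 = [:b0, b1, b2:]"
    using poly_eq_quadratic[of "g 2"] degree_sum[of 2] by auto
  have eq: "[:a0, a1, a2:] * ([:b0, b1, b2:] \<circ>\<^sub>p [:1, 1:]) - [:b0, b1, b2:] * ([:a0, a1, a2:] \<circ>\<^sub>p [:- 2, 1:]) = [:3 * k:]"
    using rel_poly[of "- 1" 2] by (simp add: a b k)
  \<comment> \<open>The right-hand side of \<open>eq\<close> is constant. Once the higher b_i
    vanish, the coefficient of t^(j+1) on the left is (j + 4) a2 b_j, so j = 2, 1, 0 give b_j = 0 in
    turn and \<open>g 2\<close> would be 0.\<close>
  have "coeff ([:a0, a1, a2:] * ([:b0, b1, b2:] \<circ>\<^sub>p [:1, 1:]) - [:b0, b1, b2:] * ([:a0, a1, a2:] \<circ>\<^sub>p [:- 2, 1:])) (Suc (Suc (Suc 0))) = 6 * a2 * b2"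
    by (simp add: pcompose_pCons algebra_simps)
  then have b2: "b2 = 0" unfolding eq using \<open>a2 \<noteq> 0\<close> by simp
  have "coeff ([:a0, a1, a2:] * ([:b0, b1, b2:] \<circ>\<^sub>p [:1, 1:]) - [:b0, b1, b2:] * ([:a0, a1, a2:] \<circ>\<^sub>p [:- 2, 1:])) (Suc (Suc 0)) = 5 * a2 * b1"
    unfolding b2 by (simp add: pcompose_pCons algebra_simps)
  then have b1: "b1 = 0" unfolding eq using \<open>a2 \<noteq> 0\<close> by simp
  have "coeff ([:a0, a1, a2:] * ([:b0, b1, b2:] \<circ>\<^sub>p [:1, 1:]) - [:b0, b1, b2:] * ([:a0, a1, a2:] \<circ>\<^sub>p [:- 2, 1:])) (Suc 0) = 4 * a2 * b0"
    unfolding b2 b1 by (simp add: pcompose_pCons algebra_simps)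
  then have b0: "b0 = 0" unfolding eq using \<open>a2 \<noteq> 0\<close> by simp
  show False using degree_sum(2)[of 2] by (simp add: b b0 b1 b2)
qed

text \<open>The reflection exchanges \<open>g 1\<close> and \<open>g (- 1)\<close> up to sign and
  argument, so neither has degree 2; as the degrees add up to 2, neither is 0.\<close>

lemma degree_one: "degree (g 1) = 1" "degree (g (- 1)) = 1"
proof -
  have "degree (g 1) \<noteq> 2"
    using virasoro_poly.degree_minus_one[OF reflect] by (simp add: degree_pcompose)
  with degree_minus_one show "degree (g 1) = 1" "degree (g (- 1)) = 1"
    using degree_sum[of 1] by auto
qed

text \<open>\<open>lam\<close> and \<alpha> are read off from \<open>g 1\<close>; the product g_1(t)
  g_{-1}(t - 1) then fixes \<open>g (- 1)\<close>, [L_{-1}, L_2] = 3 L_1 fixes \<open>g 2\<close>,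
  and [L_1, L_n] = (n - 1) L_{n+1} the rest. The formula for \<open>g (- 1)\<close> links the two
  halves in \<open>form\<close>.\<close>

lemma nonneg_form:
  obtains lam \<alpha> where "lam \<noteq> 0" "g (- 1) = Polynomial.smult (inverse lam) [:\<alpha>, 1:]"
    "\<And>n. n \<ge> 0 \<Longrightarrow> g n = Polynomial.smult (lam powi n) [:- (of_int n * \<alpha>), 1:]"
proof -
  obtain k lam where g1': "g 1 = [:k, lam:]" "lam \<noteq> 0"
    using degree1_coeffs[OF degree_one(1)] by metis
  define \<alpha> where "\<alpha> = - k / lam"
  have g1: "g 1 = Polynomial.smult lam [:- \<alpha>, 1:]"
    using g1' by (simp add: \<alpha>_def)
  obtain k' mu where gm': "g (- 1) = [:k', mu:]" "mu \<noteq> 0"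
    using degree1_coeffs[OF degree_one(2)] by metis
  \<comment> \<open>The linear coefficient is free of \<open>c\<close> here because n^2 - 1 vanishes
    at n = 1.\<close>
  obtain d where F: "g 1 * (g (- 1) \<circ>\<^sub>p [:- 1, 1:]) = [:d, - 1, 1:]"
    using product_quadratic[of 1] by (metis (no_types, lifting) diff_self div_0 diff_0_right
      mult_zero_left of_int_1 one_power2 zero_neq_one)
  have 1: "lam * mu = 1" and "1 + lam * k' = lam * mu + \<alpha> * (lam * mu)"
    using F by (simp_all add: g1 gm' pcompose_pCons algebra_simps)
  then have "lam * k' = \<alpha>" by simp
  with 1 have "mu = inverse lam" "k' = \<alpha> * inverse lam"
    using g1'(2) by (auto simp: field_simps)
  then have gm: "g (- 1) = Polynomial.smult (inverse lam) [:\<alpha>, 1:]"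
    by (simp add: gm')
  have g2: "g 2 = Polynomial.smult (lam powi 2) [:- (of_int 2 * \<alpha>), 1:]"
  proof -
    obtain b0 b1 b2 where b: "g 2 = [:b0, b1, b2:]"
      using poly_eq_quadratic[of "g 2"] degree_sum[of 2] by auto
    \<comment> \<open>The factor \<open>lam\<close> cancels the \<open>inverse lam\<close> in
      \<open>g (- 1)\<close>.\<close>
    have "Polynomial.smult lam (g (- 1) * (g 2 \<circ>\<^sub>p [:1, 1:]) - g 2 * (g (- 1) \<circ>\<^sub>p [:- 2, 1:])) =
        Polynomial.smult lam (Polynomial.smult 3 (g 1))"
      using rel_poly[of "- 1" 2] by simp
    then have "[:\<alpha>, 1:] * (g 2 \<circ>\<^sub>p [:1, 1:]) - g 2 * ([:\<alpha>, 1:] \<circ>\<^sub>p [:- 2, 1:]) =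
        Polynomial.smult (3 * lam * lam) [:- \<alpha>, 1:]"
      using g1'(2) by (simp add: g1 gm smult_diff_right pcompose_smult mult.commute mult.left_commute
        del: smult_pCons mult_pCons_left mult_pCons_right)
    then have b2: "b2 = 0" and b1: "b1 = lam ^ 2"
      and b0: "\<alpha> * b1 + 2 * b0 = - 3 * \<alpha> * lam ^ 2"
      by (auto simp: b pcompose_pCons power2_eq_square algebra_simps)
    from b0 have "2 * b0 = 2 * (- 2 * \<alpha> * lam ^ 2)"
      unfolding b1 by (simp add: eq_neg_iff_add_eq_0 algebra_simps)
    then have "b0 = - 2 * \<alpha> * lam ^ 2" by (simp only: mult_cancel_left) simp
    then show ?thesis by (simp add: b b1 b2)
  qed
  \<comment> \<open>The induction starts at 2 since the factor n - 1 vanishes at n = 1.\<close>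
  have step: "g n = Polynomial.smult (lam powi n) [:- (of_int n * \<alpha>), 1:]" if "n \<ge> 2" for n
    using that
  proof (induction n rule: int_ge_induct)
    case base
    show ?case by (rule g2)
  next
    case (step n)
    have "Polynomial.smult (of_int (n - 1)) (g (n + 1)) =
        g 1 * (g n \<circ>\<^sub>p [:- 1, 1:]) - g n * (g 1 \<circ>\<^sub>p [:- of_int n, 1:])"
      using rel_poly[of 1 n] step.hyps by (simp add: add.commute)
    also have "\<dots> = Polynomial.smult (of_int (n - 1)) (Polynomial.smult (lam powi (n + 1)) [:- (of_int (n + 1) * \<alpha>), 1:])"
      unfolding step.IH g1
      using g1'(2) by (simp add: pcompose_pCons power_int_add algebra_simps)
    finally have *: "Polynomial.smult (of_int (n - 1)) (g (n + 1)) =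
      Polynomial.smult (of_int (n - 1)) (Polynomial.smult (lam powi (n + 1)) [:- (of_int (n + 1) * \<alpha>), 1:])" .
    have "n - 1 \<noteq> 0" using step.hyps by simp
    then have "of_int (n - 1) \<noteq> (0 :: complex)" by (simp only: of_int_eq_0_iff) simp
    then have inj: "p = q" if "Polynomial.smult (of_int (n - 1)) p = Polynomial.smult (of_int (n - 1)) q" for p q :: "complex poly"
      using arg_cong[OF that, of "Polynomial.smult (inverse (of_int (n - 1)))"] by simp
    show ?case by (rule inj[OF *])
  qed
  have "g n = Polynomial.smult (lam powi n) [:- (of_int n * \<alpha>), 1:]" if n: "n \<ge> 0" for n
  proof -
    consider "n = 0" | "n = 1" | "n \<ge> 2" using n by linarith
    then show ?thesis using step g0 g1 by cases simp_all
  qed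
  with that gm g1'(2) show thesis by blast
qed

text \<open>Negative indices come from the reflected family; the value of \<open>g (- 1)\<close>,
  known from both sides, forces its parameters to be \<open>inverse lam\<close> and
  \<alpha>.\<close>

lemma form:
  obtains lam \<alpha> where "lam \<noteq> 0" "\<And>n. g n = Polynomial.smult (lam powi n) [:- (of_int n * \<alpha>), 1:]"
proof -
  obtain lam \<alpha> where 1: "lam \<noteq> 0" "g (- 1) = Polynomial.smult (inverse lam) [:\<alpha>, 1:]"
    "\<And>n. n \<ge> 0 \<Longrightarrow> g n = Polynomial.smult (lam powi n) [:- (of_int n * \<alpha>), 1:]"
    using nonneg_form by metis
  obtain lam' \<alpha>' where 2: "lam' \<noteq> 0"
    "\<And>n. n \<ge> 0 \<Longrightarrow> - (g (- n) \<circ>\<^sub>p [:0, -1:]) = Polynomial.smult (lam' powi n) [:- (of_int n * \<alpha>'), 1:]"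
    using virasoro_poly.nonneg_form[OF reflect] by metis
  have eqs: "lam' = inverse lam" "\<alpha>' = \<alpha>"
    using 2(2)[of 1] 2(1) by (auto simp: 1 pcompose_pCons)
  have "g n = Polynomial.smult (lam powi n) [:- (of_int n * \<alpha>), 1:]" if "n < 0" for n
  proof -
    have "g n = - (- (g (- (- n)) \<circ>\<^sub>p [:0, -1:]) \<circ>\<^sub>p [:0, -1:])"
      by (rule poly_eqI_eval) (simp add: poly_pcompose)
    also have "\<dots> = - (Polynomial.smult (lam' powi (- n)) [:- (of_int (- n) * \<alpha>'), 1:] \<circ>\<^sub>p [:0, -1:])"
      using 2(2)[of "- n"] that by simp
    also have "\<dots> = Polynomial.smult (lam powi n) [:- (of_int n * \<alpha>), 1:]"
      by (simp add: eqs pcompose_pCons power_int_inverse power_int_minus)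
    finally show ?thesis .
  qed
  then show thesis using 1 that by (metis not_less)
qed

text \<open>The linear g_n already satisfy the relations without central term, and 2 is the least
  positive m with m^3 - m nonzero.\<close>

lemma central_zero: "c = 0"
proof -
  obtain lam \<alpha> where 1: "lam \<noteq> 0" "\<And>n. g n = Polynomial.smult (lam powi n) [:- (of_int n * \<alpha>), 1:]"
    using form by metis
  show ?thesis
    using rel[of 2 0 "- 2"] 1(1) by (simp add: 1(2) field_simps power_int_minus)
qed

end

section \<open>The Heisenberg relations\<close>

text \<open>\<open>h n\<close> is I_n . 1, \<open>c\<close> the scalar of C_2, and
  \<open>rel\<close> the bracket [L_m, I_n] with the known L_m inserted. For constant
  \<open>h n\<close> it becomes a recurrence: n = 1 expresses all values by p(1), (m, n) = (-1, 1),
  where m^2 + m = 0, gives p(1), and (1, -1) gives c = 0.\<close>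

lemma heisenberg_poly:
  fixes h :: "int \<Rightarrow> complex poly"
  assumes lam: "lam \<noteq> 0" and h0: "h 0 = [:\<beta>:]"
    and rel: "\<And>m n t. lam powi m * ((t - of_int m * \<alpha>) * poly (h n) (t - of_int m)
        - poly (h n) t * (t - of_int n - of_int m * \<alpha>)) =
      of_int n * poly (h (m + n)) t + (if m + n = 0 then of_int (m ^ 2 + m) * c else 0)"
  shows "h n = [:\<beta> * lam powi n:]" and "c = 0"
proof -
  have const: "\<exists>k. h n = [:k:]" for n
  proof (cases "n = 0")
    case False
    \<comment> \<open>the relation with \<open>m = - n\<close> makes \<open>H\<close> have constant differences, so \<open>H\<close> is at most linear\<close>
    define H where "H = [:of_int n * \<alpha> - of_int n, 1:] * h n"
    define K where "K = lam powi n * (of_int n * \<beta> + of_int (n ^ 2 - n) * c)"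
    have "poly H (t + of_int n) - poly H t = 0 * t + K" for t
      using rel[of "- n" t n] lam h0 by (simp add: H_def K_def power_int_minus field_simps)
    then obtain d where "H = [:d, K / of_int n - 0 / 2, 0 / (2 * of_int n):]"
      using linear_difference_poly[of "of_int n" H 0 K] False by (metis of_int_eq_0_iff)
    then have H: "H = [:d, K / of_int n:]" by simp
    show ?thesis
    proof (cases "h n = 0")
      \<comment> \<open>\<open>H\<close> is \<open>h n\<close> times a linear factor and has degree
        at most 1, so \<open>h n\<close> has degree 0.\<close>
      case False
      then have "degree H = Suc (degree (h n))"
        unfolding H_def by (subst degree_mult_eq) auto
      moreover have "degree H \<le> 1" by (simp add: H)
      ultimately show ?thesis using degree_eq_zeroE by (metis One_nat_def Suc_le_mono le_zero_eq)
    qed (auto intro: exI[of _ 0])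
  qed (use h0 in auto)
  then obtain p where p: "\<And>n. h n = [:p n:]" by metis
  have p0: "p 0 = \<beta>" using h0 p by simp
  have rel': "lam powi m * (of_int n * p n) = of_int n * p (m + n) + (if m + n = 0 then of_int (m ^ 2 + m) * c else 0)" for m n
    using rel[of m 0 n] by (simp add: p algebra_simps)
  have pn: "lam powi m * p 1 = p (m + 1)" if "m \<noteq> - 1" for m
    using rel'[of m 1] that by (auto split: if_splits)
  have p1: "p 1 = lam * \<beta>"
    using rel'[of "- 1" 1] p0 lam by (simp add: power_int_minus field_simps)
  have "p n = \<beta> * lam powi n" for n
    using pn[of "n - 1"] p1 lam p0 by (cases "n = 0") (auto simp: power_int_diff field_simps)
  then show "h n = [:\<beta> * lam powi n:]" by (simp add: p)
  show "c = 0"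
    using rel'[of 1 "- 1"] \<open>\<And>n. p n = \<beta> * lam powi n\<close> lam by (simp add: power_int_minus field_simps)
qed

section \<open>Module structures on C[t] in which L_0 is multiplication by t\<close>

locale hv_poly_module =
  fixes T :: "hv \<Rightarrow> complex poly \<Rightarrow> complex poly"
  assumes add_left: "T (x + y) p = T x p + T y p"
    and scale_left: "T (hv_scale k x) p = Polynomial.smult k (T x p)"
    and add_right: "T x (p + q) = T x p + T x q"
    and smult_right: "T x (Polynomial.smult k p) = Polynomial.smult k (T x p)"
    and bracket: "T (hv_bracket x y) p = T x (T y p) - T y (T x p)"
    and L0: "T (Poly_Mapping.single (L 0) 1) p = [:0, 1:] * p"
begin

lemma single: "T (Poly_Mapping.single a k) p = Polynomial.smult k (T (Poly_Mapping.single a 1) p)"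
  using scale_left[of k "Poly_Mapping.single a 1" p] by simp

lemma zero_left: "T 0 p = 0"
  using add_left[of 0 0 p] by simp

lemma uminus_left: "T (- x) p = - T x p"
  using add_left[of x "- x" p] by (simp add: zero_left eq_neg_iff_add_eq_0 add.commute)

lemma bracket_basis: "T (hv_bracket_basis a b) p =
    T (Poly_Mapping.single a 1) (T (Poly_Mapping.single b 1) p) -
    T (Poly_Mapping.single b 1) (T (Poly_Mapping.single a 1) p)"
  using bracket[of "Poly_Mapping.single a 1" "Poly_Mapping.single b 1" p]
  by (simp add: hv_bracket_single)

definition G :: "hv_basis \<Rightarrow> complex poly" where
  "G a = T (Poly_Mapping.single a 1) 1"

text \<open>The eigenvalue of the basis vector under the adjoint action of L_0.\<close>

fun weight :: "hv_basis \<Rightarrow> int" where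
  "weight (L n) = n" | "weight (I n) = n" | "weight _ = 0"

lemma L0_bracket: "hv_bracket_basis (L 0) a = Poly_Mapping.single a (of_int (weight a))"
  by (cases a) auto

text \<open>By [L_0, a] = w a, moving \<open>a\<close> past multiplication by t replaces t by t - w.
  Hence the value at 1 determines the action of \<open>a\<close>.\<close>

lemma T_basis: "T (Poly_Mapping.single a 1) p = G a * (p \<circ>\<^sub>p [:- of_int (weight a), 1:])"
proof (induction p)
  case 0
  show ?case using add_right[of "Poly_Mapping.single a 1" 0 0] by simp
next
  case (pCons k p)
  have t: "T (Poly_Mapping.single a 1) ([:0, 1:] * q) = [:- of_int (weight a), 1:] * T (Poly_Mapping.single a 1) q" for q
  proof -
    have "Polynomial.smult (of_int (weight a)) (T (Poly_Mapping.single a 1) q) =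
        [:0, 1:] * T (Poly_Mapping.single a 1) q - T (Poly_Mapping.single a 1) ([:0, 1:] * q)"
      using bracket_basis[of "L 0" a q]
      by (simp only: L0_bracket L0 single[of a "of_int (weight a)"])
    then show ?thesis by (simp add: algebra_simps)
  qed
  have "pCons k p = Polynomial.smult k 1 + [:0, 1:] * p" by simp
  then have "T (Poly_Mapping.single a 1) (pCons k p) =
      Polynomial.smult k (G a) + [:- of_int (weight a), 1:] * T (Poly_Mapping.single a 1) p"
    by (simp only: add_right smult_right t G_def)
  then show ?case by (simp only: pCons.IH pcompose_pCons) (simp add: algebra_simps)
qed

lemma G_relation: "poly (G a) t * poly (G b) (t - of_int (weight a)) -
    poly (G b) t * poly (G a) (t - of_int (weight b)) = poly (T (hv_bracket_basis a b) 1) t"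
  by (simp add: bracket_basis T_basis poly_pcompose)

text \<open>Otherwise [L_1, L_{-1}] = -2 L_0 would annihilate 1, but L_0 . 1 = t.\<close>

lemma G_L1_nonzero: "G (L 1) \<noteq> 0"
proof
  assume "G (L 1) = 0"
  then have "poly (T (Poly_Mapping.single (L 0) (- 2)) 1) 1 = 0"
    using G_relation[of "L 1" 1 "L (- 1)"] by simp
  then show False by (simp add: single[of _ "- 2"] L0)
qed

text \<open>Meant for C_1, C_2, C_3 and I_0. Commuting with L_1 gives g_1(t) (G_a(t) - G_a(t - 1)) =
  0; cancelling the nonzero g_1 makes \<open>G a\<close> periodic.\<close>

lemma central_const:
  assumes "weight a = 0" "hv_bracket_basis a (L 1) = 0"
  obtains k where "G a = [:k:]"
proof -
  have "poly (G (L 1) * (G a - G a \<circ>\<^sub>p [:- 1, 1:])) t = 0" for t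
    using G_relation[of a t "L 1"] assms by (simp add: zero_left poly_pcompose algebra_simps)
  then have "G (L 1) * (G a - G a \<circ>\<^sub>p [:- 1, 1:]) = 0"
    by (metis poly_eqI_eval poly_0)
  then have "G a = G a \<circ>\<^sub>p [:- 1, 1:]"
    using G_L1_nonzero by simp
  then have "poly (G a) t = poly (G a) (t - 1)" for t
    by (metis poly_pcompose poly_pCons poly_0 add.commute add_uminus_conv_diff mult.right_neutral mult_zero_right add_0_right)
  from this[of "_ + 1"] have "poly (G a) (t + 1) = poly (G a) t" for t
    by simp
  from periodic_poly_const[OF _ this] that show thesis by simp
qed

theorem classification:
  obtains lam \<alpha> \<beta> where "lam \<noteq> 0" "T = Omega_act lam \<alpha> \<beta>"
proof -
  obtain c1 where c1: "G C1 = [:c1:]" by (rule central_const[of C1]) simp_all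
  obtain c2 where c2: "G C2 = [:c2:]" by (rule central_const[of C2]) simp_all
  obtain c3 where c3: "G C3 = [:c3:]" by (rule central_const[of C3]) simp_all
  obtain \<beta> where \<beta>: "G (I 0) = [:\<beta>:]" by (rule central_const[of "I 0"]) simp_all
  have single_1: "T (Poly_Mapping.single a k) 1 = Polynomial.smult k (G a)" for a k
    by (simp add: single[of a k] G_def)
  interpret virasoro_poly "\<lambda>n. G (L n)" c1
  proof
    show "G (L 0) = [:0, 1:]" by (simp add: G_def L0)
    show "poly (G (L m)) t * poly (G (L n)) (t - of_int m) - poly (G (L n)) t * poly (G (L m)) (t - of_int n) =
      of_int (n - m) * poly (G (L (m + n))) t + (if m + n = 0 then of_int (m ^ 3 - m) / 12 * c1 else 0)" for m n t
      using G_relation[of "L m" t "L n"]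
      by (simp add: add_left zero_left single_1 c1)
  qed
  obtain lam \<alpha> where lam: "lam \<noteq> 0"
    and GL: "\<And>n. G (L n) = Polynomial.smult (lam powi n) [:- (of_int n * \<alpha>), 1:]"
    using form by metis
  have rel: "lam powi m * ((t - of_int m * \<alpha>) * poly (G (I n)) (t - of_int m)
        - poly (G (I n)) t * (t - of_int n - of_int m * \<alpha>)) =
      of_int n * poly (G (I (m + n))) t + (if m + n = 0 then of_int (m ^ 2 + m) * c2 else 0)" for m n t
    using G_relation[of "L m" t "I n"]
    by (simp add: add_left zero_left single_1 c2 GL algebra_simps)
  have GI: "\<And>n. G (I n) = [:\<beta> * lam powi n:]" and "c2 = 0"
    using heisenberg_poly[of lam "\<lambda>n. G (I n)", OF lam \<beta> rel] by simp_all
  \<comment> \<open>The I_n act by constants times shifts, so they commute and [I_1, I_{-1}] = C_3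
    acts as 0.\<close>
  have "c3 = 0"
    using G_relation[of "I 1" 0 "I (- 1)"] by (simp add: GI single_1 c3)
  have "T (Poly_Mapping.single a 1) p = Omega_basis lam \<alpha> \<beta> a p" for a p
    by (cases a) (simp_all add: smult_diff_right T_basis GL GI c1 c2 c3 central_zero \<open>c2 = 0\<close> \<open>c3 = 0\<close>)
  then have "T x p = Omega_act lam \<alpha> \<beta> x p" for x p
  proof (induction x rule: pm_induct)
    case (single a k)
    then show ?case using hv_poly_module.single[OF hv_poly_module_axioms, of a k p] by simp
  qed (simp add: Omega_act_add add_left)
  with lam that show thesis by blast
qed

end

section \<open>The free algebra and its evaluations in C[t]\<close>

lemma scalar_0 [simp]: "scalar 0 = 0"
  by (simp add: scalar_def)

lemma scalar_add: "scalar (a + b) = scalar a + scalar b"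
  by (simp add: scalar_def Poly_Mapping.single_add)

lemma scalar_mult: "scalar (a * b) = scalar a * scalar b"
  by (simp add: scalar_def mult_single)

lemma scalar_commute: "scalar a * f = f * scalar a"
  by (induction f rule: pm_induct) (simp_all add: scalar_def mult_single algebra_simps)

text \<open>A monomial is a scalar multiplied on the left by its letters one by one, and every
  element is the sum of its monomials.\<close>

lemma free_algebra_induct [consumes 1, case_names scalar gen add]:
  assumes "f \<in> carrier (free_algebra A)"
    and scalar: "\<And>c. P (scalar c)"
    and gen: "\<And>x f. x \<in> A \<Longrightarrow> f \<in> carrier (free_algebra A) \<Longrightarrow> P f \<Longrightarrow> P (gen x * f)"
    and add: "\<And>f h. f \<in> carrier (free_algebra A) \<Longrightarrow> h \<in> carrier (free_algebra A) \<Longrightarrow>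
      P f \<Longrightarrow> P h \<Longrightarrow> P (f + h)"
  shows "P f"
proof -
  have single: "Poly_Mapping.single w c \<in> carrier (free_algebra A) \<and> P (Poly_Mapping.single w c)"
    if "set (letters w) \<subseteq> A" for w c
    using that
  proof (induction "letters w" arbitrary: w)
    case Nil
    then have "Poly_Mapping.single w c = scalar c"
      by (cases w) (simp add: scalar_def zero_wd_def)
    with scalar show ?case by (simp add: free_algebra_closed)
  next
    case (Cons x l)
    have "Poly_Mapping.single w c = gen x * Poly_Mapping.single (Wd l) c"
      using Cons.hyps(2) by (cases w) (simp add: gen_def mult_single plus_wd_def)
    moreover have "x \<in> A" "set l \<subseteq> A" using Cons.prems Cons.hyps(2)[symmetric] by auto
    ultimately show ?case using gen Cons.hyps(1)[of "Wd l"]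
      by (simp add: free_algebra_closed)
  qed
  have "(\<Sum>w\<in>S. Poly_Mapping.single w (Poly_Mapping.lookup f w)) \<in> carrier (free_algebra A) \<and>
      P (\<Sum>w\<in>S. Poly_Mapping.single w (Poly_Mapping.lookup f w))"
    if "S \<subseteq> Poly_Mapping.keys f" for S
    using finite_subset[OF that finite_keys] that
  proof (induction S rule: finite_induct)
    case empty
    show ?case using scalar[of 0] free_algebra_closed(5)[of 0] by simp
  next
    case (insert w S)
    then have "set (letters w) \<subseteq> A" using assms(1) by (auto simp: free_algebra_carrier)
    with insert show ?case
      using single[of w "Poly_Mapping.lookup f w"] add by (auto simp: free_algebra_closed)
  qed
  moreover have "(\<Sum>w\<in>Poly_Mapping.keys f. Poly_Mapping.single w (Poly_Mapping.lookup f w)) = f"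
    by (rule poly_mapping_eqI)
      (auto simp: lookup_sum lookup_single when_def sum.delta in_keys_iff)
  ultimately show ?thesis by (metis order_refl)
qed

text \<open>The algebra homomorphism to C[t] extending \<open>u\<close>. It will separate
  polynomials in L_0 modulo the defining relations.\<close>

definition free_eval :: "('a \<Rightarrow> complex poly) \<Rightarrow> 'a free_elem \<Rightarrow> complex poly" where
  "free_eval u f = (\<Sum>w \<in> Poly_Mapping.keys f.
     Polynomial.smult (Poly_Mapping.lookup f w) (\<Prod>x\<leftarrow>letters w. u x))"

lemma free_eval_superset:
  assumes "finite A" "Poly_Mapping.keys f \<subseteq> A"
  shows "free_eval u f = (\<Sum>w\<in>A. Polynomial.smult (Poly_Mapping.lookup f w) (\<Prod>x\<leftarrow>letters w. u x))"
  unfolding free_eval_def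
  by (intro sum.mono_neutral_left) (use assms in \<open>auto simp: in_keys_iff\<close>)

lemma free_eval_single [simp]:
  "free_eval u (Poly_Mapping.single w c) = Polynomial.smult c (\<Prod>x\<leftarrow>letters w. u x)"
  by (subst free_eval_superset[where A = "{w}"]) auto

lemma free_eval_add [simp]: "free_eval u (f + h) = free_eval u f + free_eval u h"
proof -
  let ?A = "Poly_Mapping.keys f \<union> Poly_Mapping.keys h"
  show ?thesis
    by (subst (1 2 3) free_eval_superset[where A = ?A])
      (use Poly_Mapping.keys_add[of f h] in \<open>auto simp: lookup_add smult_add_left sum.distrib\<close>)
qed

lemma free_eval_diff [simp]: "free_eval u (f - h) = free_eval u f - free_eval u h"
  using free_eval_add[of u "f - h" h] by simp

lemma free_eval_0 [simp]: "free_eval u 0 = 0"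
  by (simp add: free_eval_def)

lemma free_eval_mult [simp]: "free_eval u (f * h) = free_eval u f * free_eval u h"
proof (induction f rule: pm_induct)
  case (single w c)
  show ?case
    by (induction h rule: pm_induct) (simp_all add: mult_single plus_wd_def smult_add_right algebra_simps)
qed (simp add: algebra_simps)

lemma free_eval_gen [simp]: "free_eval u (gen x) = u x"
  by (simp add: gen_def)

lemma free_eval_scalar [simp]: "free_eval u (scalar c) = [:c:]"
  by (simp add: scalar_def zero_wd_def)

text \<open>The value of \<open>p\<close> at the generator \<open>x\<close>, in Horner form so that
  multiplying \<open>p\<close> by t becomes left multiplication by \<open>gen x\<close>.\<close>

definition poly_elem :: "'a \<Rightarrow> complex poly \<Rightarrow> 'a free_elem" where
  "poly_elem x p = fold_coeffs (\<lambda>a f. scalar a + gen x * f) p 0"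

lemma poly_elem_0 [simp]: "poly_elem x 0 = 0"
  by (simp add: poly_elem_def)

lemma poly_elem_pCons: "poly_elem x (pCons a p) = scalar a + gen x * poly_elem x p"
  by (cases "p = 0 \<and> a = 0") (auto simp: poly_elem_def)

lemma poly_elem_const: "poly_elem x [:c:] = scalar c"
  by (simp add: poly_elem_pCons)

lemma poly_elem_add: "poly_elem x (p + q) = poly_elem x p + poly_elem x q"
  by (induction p q rule: poly_induct2) (simp_all add: poly_elem_pCons scalar_add algebra_simps)

lemma poly_elem_smult: "poly_elem x (Polynomial.smult c p) = scalar c * poly_elem x p"
proof (induction p)
  case (pCons a p)
  have "scalar c * (gen x * poly_elem x p) = gen x * (scalar c * poly_elem x p)"
    by (simp only: mult.assoc[symmetric] scalar_commute[of c "gen x"])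
  with pCons show ?case by (simp add: poly_elem_pCons scalar_mult distrib_left)
qed simp

lemma poly_elem_closed: "x \<in> A \<Longrightarrow> poly_elem x p \<in> carrier (free_algebra A)"
proof (induction p)
  case 0
  show ?case using free_algebra_closed(5)[of 0] by simp
qed (simp add: poly_elem_pCons free_algebra_closed)

lemma free_eval_poly_elem:
  assumes "u x = [:0, 1:]"
  shows "free_eval u (poly_elem x p) = p"
  by (induction p) (simp_all add: poly_elem_pCons assms)

section \<open>Enveloping algebras and the structure of U(C L_0)\<close>

context
  fixes scale :: "complex \<Rightarrow> 'g::ab_group_add \<Rightarrow> 'g" and bracket :: "'g \<Rightarrow> 'g \<Rightarrow> 'g" and \<gg> :: "'g set"
  assumes closed: "\<And>x y. x \<in> \<gg> \<Longrightarrow> y \<in> \<gg> \<Longrightarrow> x + y \<in> \<gg>" "\<And>c x. x \<in> \<gg> \<Longrightarrow> scale c x \<in> \<gg>"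
    "\<And>x y. x \<in> \<gg> \<Longrightarrow> y \<in> \<gg> \<Longrightarrow> bracket x y \<in> \<gg>"
begin

interpretation ideal "uea_ideal scale bracket \<gg>" "free_algebra \<gg>"
  by (rule ideal_uea_ideal[OF closed])

lemma carrier_uea: "carrier (uea scale bracket \<gg>) = uea_class scale bracket \<gg> ` carrier (free_algebra \<gg>)"
  by (auto simp: uea_def uea_class_def FactRing_def A_RCOSETS_def')

lemma uea_class_hom: "uea_class scale bracket \<gg> \<in> ring_hom (free_algebra \<gg>) (uea scale bracket \<gg>)"
  using rcos_ring_hom by (simp add: uea_class_def[abs_def] uea_def)

lemma uea_class_eq_iff:
  assumes "f \<in> carrier (free_algebra \<gg>)" "h \<in> carrier (free_algebra \<gg>)"
  shows "uea_class scale bracket \<gg> f = uea_class scale bracket \<gg> h \<longleftrightarrow> f - h \<in> uea_ideal scale bracket \<gg>"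
proof -
  have "\<ominus>\<^bsub>free_algebra \<gg>\<^esub> h = - h"
    by (rule minus_equality) (use assms in \<open>simp_all add: free_algebra_closed\<close>)
  then have "f \<ominus>\<^bsub>free_algebra \<gg>\<^esub> h = f - h" by (simp add: a_minus_def)
  with quotient_eq_iff_same_a_r_cos[OF ideal_axioms assms] show ?thesis
    by (simp add: uea_class_def)
qed

lemma uea_relations_subset: "uea_relations scale bracket \<gg> \<subseteq> uea_ideal scale bracket \<gg>"
  unfolding uea_ideal_def
  by (rule genideal_self) (auto simp: uea_relations_def intro!: free_algebra_closed closed)

text \<open>The commutator relation is written with a sum instead of a difference, to be expanded by
  additivity when it acts on a module.\<close>

lemma uea_class_relations:
  "x \<in> \<gg> \<Longrightarrow> y \<in> \<gg> \<Longrightarrow> uea_class scale bracket \<gg> (gen (x + y)) = uea_class scale bracket \<gg> (gen x + gen y)"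
  "x \<in> \<gg> \<Longrightarrow> uea_class scale bracket \<gg> (gen (scale c x)) = uea_class scale bracket \<gg> (scalar c * gen x)"
  "x \<in> \<gg> \<Longrightarrow> y \<in> \<gg> \<Longrightarrow> uea_class scale bracket \<gg> (gen x * gen y) =
    uea_class scale bracket \<gg> (gen (bracket x y) + gen y * gen x)"
proof -
  show "uea_class scale bracket \<gg> (gen (x + y)) = uea_class scale bracket \<gg> (gen x + gen y)"
    if "x \<in> \<gg>" "y \<in> \<gg>"
    using that uea_relations_subset
    by (subst uea_class_eq_iff) (auto intro!: free_algebra_closed closed simp: uea_relations_def)
  show "uea_class scale bracket \<gg> (gen (scale c x)) = uea_class scale bracket \<gg> (scalar c * gen x)"
    if "x \<in> \<gg>"
    using that uea_relations_subset
    by (subst uea_class_eq_iff) (auto intro!: free_algebra_closed closed simp: uea_relations_def)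
  show "uea_class scale bracket \<gg> (gen x * gen y) =
      uea_class scale bracket \<gg> (gen (bracket x y) + gen y * gen x)" if "x \<in> \<gg>" "y \<in> \<gg>"
  proof -
    have "gen x * gen y - gen y * gen x - gen (bracket x y) \<in> uea_relations scale bracket \<gg>"
      unfolding uea_relations_def using that by blast
    then have "gen x * gen y - (gen (bracket x y) + gen y * gen x) \<in> uea_ideal scale bracket \<gg>"
      using uea_relations_subset by (auto simp: algebra_simps)
    then show ?thesis
      using that by (subst uea_class_eq_iff) (auto intro!: free_algebra_closed closed)
  qed
qed

end

text \<open>\<open>U(\<complex>L\<^sub>0)\<close> is the polynomial algebra in \<open>L\<^sub>0\<close>: evaluating \<open>c L\<^sub>0\<close> at \<open>c t\<close> inverts
  \<^const>\<open>poly_elem\<close> because it kills the defining relations.\<close>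

lemma bij_betw_poly_U_CL0:
  "bij_betw (\<lambda>p. uea_class hv_scale hv_bracket CL0 (poly_elem (Poly_Mapping.single (L 0) 1) p))
    UNIV (carrier U_CL0)"
proof -
  define e :: hv where "e = Poly_Mapping.single (L 0) 1"
  define u :: "hv \<Rightarrow> complex poly" where "u x = [:0, Poly_Mapping.lookup x (L 0):]" for x
  let ?F = "free_algebra CL0"
  let ?cls = "uea_class hv_scale hv_bracket CL0"
  interpret F: ring ?F by (rule ring_free_algebra)
  have e: "e \<in> CL0" unfolding CL0_def e_def using hv.scale_one by force
  have ue: "u e = [:0, 1:]" by (simp add: u_def e_def)
  \<comment> \<open>The kernel of the evaluation. It contains the commutator relations because
    brackets vanish on \<open>CL0\<close> and C[t] is commutative.\<close>
  let ?K = "{f \<in> carrier ?F. free_eval u f = 0}"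
  have neg: "\<ominus>\<^bsub>?F\<^esub> f = - f" if "f \<in> carrier ?F" for f
    using that F.minus_equality[of "- f" f] by (simp add: free_algebra_closed)
  have "ideal ?K ?F"
  proof (rule idealI)
    show "subgroup ?K (add_monoid ?F)"
    proof (rule F.add.subgroupI)
      fix a assume "a \<in> ?K"
      then show "\<ominus>\<^bsub>?F\<^esub> a \<in> ?K"
        using free_eval_diff[of u 0 a] by (simp add: neg free_algebra_closed)
    qed (use F.zero_closed in \<open>auto simp: free_algebra_closed\<close>)
  qed (use F.ring_axioms in \<open>auto simp: free_algebra_closed\<close>)
  moreover have "uea_relations hv_scale hv_bracket CL0 \<subseteq> ?K"
  proof -
    have "u (hv_bracket x y) = 0" if "x \<in> CL0" "y \<in> CL0" for x y
      using that by (auto simp: CL0_def hv_bracket_single u_def)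
    then show ?thesis
      by (auto simp: uea_relations_def intro!: free_algebra_closed CL0_closed)
        (auto simp: u_def lookup_add)
  qed
  ultimately have K: "uea_ideal hv_scale hv_bracket CL0 \<subseteq> ?K"
    unfolding uea_ideal_def by (rule F.genideal_minimal)
  have "inj (\<lambda>p. ?cls (poly_elem e p))"
  proof (rule injI)
    fix p q assume "?cls (poly_elem e p) = ?cls (poly_elem e q)"
    then have "poly_elem e p - poly_elem e q \<in> uea_ideal hv_scale hv_bracket CL0"
      by (subst (asm) uea_class_eq_iff) (use e in \<open>auto intro: CL0_closed poly_elem_closed\<close>)
    with K have "free_eval u (poly_elem e p - poly_elem e q) = 0" by blast
    then show "p = q" by (simp add: free_eval_poly_elem[of u e, OF ue])
  qed
  moreover have surj: "\<exists>p. ?cls f = ?cls (poly_elem e p)" if "f \<in> carrier ?F" for f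
    using that
  proof (induction rule: free_algebra_induct)
    case (scalar c)
    show ?case by (metis poly_elem_const)
  next
    case (gen x f)
    then obtain p where p: "?cls f = ?cls (poly_elem e p)" by blast
    \<comment> \<open>A generator is c L_0, so modulo the relations multiplying by it turns the
      polynomial p into c t p.\<close>
    from gen obtain c where c: "x = hv_scale c e" by (auto simp: CL0_def e_def)
    note hom = uea_class_hom[of CL0 hv_scale hv_bracket, OF CL0_closed]
    have "?cls (gen x * f) = ?cls (gen x) \<otimes>\<^bsub>U_CL0\<^esub> ?cls f"
      using ring_hom_mult[OF hom, of "gen x" f] gen by (simp add: free_algebra_closed)
    also have "\<dots> = ?cls (scalar c * gen e) \<otimes>\<^bsub>U_CL0\<^esub> ?cls (poly_elem e p)"
      using uea_class_relations(2)[of CL0 hv_scale hv_bracket e c, OF CL0_closed e] by (simp add: c p)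
    also have "\<dots> = ?cls (scalar c * gen e * poly_elem e p)"
      using ring_hom_mult[OF hom, of "scalar c * gen e" "poly_elem e p"] e
      by (simp add: free_algebra_closed poly_elem_closed)
    also have "scalar c * gen e * poly_elem e p = poly_elem e (Polynomial.smult c (pCons 0 p))"
      unfolding poly_elem_smult poly_elem_pCons by (simp add: mult.assoc)
    finally show ?case by blast
  next
    case (add f h)
    then obtain p q where pq: "?cls f = ?cls (poly_elem e p)" "?cls h = ?cls (poly_elem e q)" by blast
    note hom = uea_class_hom[of CL0 hv_scale hv_bracket, OF CL0_closed]
    have "?cls (f + h) = ?cls (poly_elem e p + poly_elem e q)"
      using ring_hom_add[OF hom, of f h] ring_hom_add[OF hom, of "poly_elem e p" "poly_elem e q"] add pq e
      by (simp add: poly_elem_closed)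
    then show ?case by (metis poly_elem_add)
  qed
  moreover have "range (\<lambda>p. ?cls (poly_elem e p)) = ?cls ` carrier ?F"
  proof
    show "range (\<lambda>p. ?cls (poly_elem e p)) \<subseteq> ?cls ` carrier ?F"
      using poly_elem_closed[OF e] by blast
    show "?cls ` carrier ?F \<subseteq> range (\<lambda>p. ?cls (poly_elem e p))"
    proof (rule image_subsetI)
      fix f assume "f \<in> carrier ?F"
      then obtain p where "?cls f = ?cls (poly_elem e p)" using surj by metis
      then show "?cls f \<in> range (\<lambda>p. ?cls (poly_elem e p))" by (rule range_eqI)
    qed
  qed
  moreover have "carrier U_CL0 = ?cls ` carrier ?F"
    by (rule carrier_uea) (rule CL0_closed; assumption)+
  ultimately show ?thesis
    unfolding bij_betw_def e_def[symmetric] by simp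
qed

section \<open>Modules over U(L) that are free of rank 1 over U(C L_0)\<close>

lemma free_algebra_UNIV [simp]: "f \<in> carrier (free_algebra UNIV)"
  by (simp add: free_algebra_carrier)

locale hv_uea_module =
  fixes M :: "(hv free_elem set, 'm) module"
  assumes left_module: "left_module U_hv M"
begin

interpretation left_module U_hv M by (rule left_module)

text \<open>Acting through representatives in the free algebra keeps cosets out of later
  computations.\<close>

definition op :: "hv free_elem \<Rightarrow> 'm \<Rightarrow> 'm" where
  "op f v = uea_class hv_scale hv_bracket UNIV f \<odot>\<^bsub>M\<^esub> v"

lemma U_hv_carrier: "carrier U_hv = range (uea_class hv_scale hv_bracket UNIV)"
  by (subst carrier_uea) auto

lemma hom: "uea_class hv_scale hv_bracket UNIV \<in> ring_hom (free_algebra UNIV) U_hv"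
  by (rule uea_class_hom) simp_all

lemma op_closed [simp]: "v \<in> carrier M \<Longrightarrow> op f v \<in> carrier M"
  by (simp add: op_def U_hv_carrier)

lemma op_add_left: "v \<in> carrier M \<Longrightarrow> op (f + h) v = op f v \<oplus>\<^bsub>M\<^esub> op h v"
  using ring_hom_add[OF hom, of f h] by (simp add: op_def U_hv_carrier smult_l_distr)

lemma op_mult: "v \<in> carrier M \<Longrightarrow> op (f * h) v = op f (op h v)"
  using ring_hom_mult[OF hom, of f h] by (simp add: op_def U_hv_carrier smult_assoc1)

lemma op_add_right:
  "v \<in> carrier M \<Longrightarrow> w \<in> carrier M \<Longrightarrow> op f (v \<oplus>\<^bsub>M\<^esub> w) = op f v \<oplus>\<^bsub>M\<^esub> op f w"
  by (simp add: op_def U_hv_carrier smult_r_distr)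

lemma op_gen_relations:
  "op (gen (x + y)) v = op (gen x + gen y) v"
  "op (gen (hv_scale c x)) v = op (scalar c * gen x) v"
  "op (gen x * gen y) v = op (gen (hv_bracket x y) + gen y * gen x) v"
  by (simp_all add: op_def uea_class_relations)

text \<open>Scalars and Lie algebra elements generate U(L), so stability under them propagates to
  every \<open>f\<close>, one letter at a time.\<close>

lemma submoduleI:
  assumes "subgroup N (add_monoid M)"
    and "\<And>c v. v \<in> N \<Longrightarrow> op (scalar c) v \<in> N" "\<And>x v. v \<in> N \<Longrightarrow> op (gen x) v \<in> N"
  shows "submodule N U_hv M"
proof (rule submodule.intro[OF assms(1)], unfold_locales)
  interpret N: subgroup N "add_monoid M" by fact
  fix a v assume "a \<in> carrier U_hv" and v: "v \<in> N"
  then obtain f where a: "a \<odot>\<^bsub>M\<^esub> v = op f v" by (auto simp: U_hv_carrier op_def)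
  have v': "v \<in> carrier M" using N.subset v by auto
  have "f \<in> carrier (free_algebra UNIV)" by simp
  then have "op f v \<in> N"
  proof (induction rule: free_algebra_induct)
    case (add f h)
    then show ?case using N.m_closed v' by (simp add: op_add_left)
  qed (use assms v v' in \<open>auto simp: op_mult\<close>)
  with a show "a \<odot>\<^bsub>M\<^esub> v \<in> N" by simp
qed

lemma iso_Omega_iff: "iso_Omega M lam \<alpha> \<beta> \<longleftrightarrow>
  (\<exists>\<phi>. bij_betw \<phi> (carrier M) UNIV \<and>
     (\<forall>v \<in> carrier M. \<forall>w \<in> carrier M. \<phi> (v \<oplus>\<^bsub>M\<^esub> w) = \<phi> v + \<phi> w) \<and>
     (\<forall>c. \<forall>v \<in> carrier M. \<phi> (op (scalar c) v) = Polynomial.smult c (\<phi> v)) \<and>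
     (\<forall>x. \<forall>v \<in> carrier M. \<phi> (op (gen x) v) = Omega_act lam \<alpha> \<beta> x (\<phi> v)))"
  by (simp add: lie_module_iso_def lie_module_of_def Omega_def op_def)

lemma exists_iso_Omega:
  assumes "free_of_rank_one U_CL0 (restrict_to_U_CL0 M)"
  shows "\<exists>lam \<alpha> \<beta>. lam \<noteq> 0 \<and> iso_Omega M lam \<alpha> \<beta>"
proof -
  let ?e = "Poly_Mapping.single (L 0) 1 :: hv"
  obtain v where v: "v \<in> carrier M"
    and bij: "bij_betw (\<lambda>a. uea_inclusion hv_scale hv_bracket UNIV a \<odot>\<^bsub>M\<^esub> v) (carrier U_CL0) (carrier M)"
    using assms by (auto simp: free_of_rank_one_def restrict_scalars_def)
  \<comment> \<open>The vector p(L_0) v; freeness makes this map bijective.\<close>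
  define \<Phi> where "\<Phi> p = op (poly_elem ?e p) v" for p
  have \<Phi>: "bij_betw \<Phi> UNIV (carrier M)"
    using bij_betw_trans[OF bij_betw_poly_U_CL0 bij]
    by (simp add: \<Phi>_def[abs_def] op_def o_def uea_inclusion_CL0_class)
  have \<Phi>_add: "\<Phi> (p + q) = \<Phi> p \<oplus>\<^bsub>M\<^esub> \<Phi> q" for p q
    by (simp add: \<Phi>_def poly_elem_add op_add_left v)
  have \<Phi>_smult: "\<Phi> (Polynomial.smult c p) = op (scalar c) (\<Phi> p)" for c p
    by (simp add: \<Phi>_def poly_elem_smult op_mult v)
  have \<Phi>_t: "\<Phi> ([:0, 1:] * p) = op (gen ?e) (\<Phi> p)" for p
    by (simp add: \<Phi>_def poly_elem_pCons op_mult v)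
  have \<Phi>_closed [simp]: "\<Phi> p \<in> carrier M" for p
    using \<Phi> by (auto simp: bij_betw_def)
  have \<Phi>_eq: "p = q" if "\<Phi> p = \<Phi> q" for p q
    using \<Phi> that by (auto simp: bij_betw_def inj_def)
  define \<phi> where "\<phi> = inv_into UNIV \<Phi>"
  \<comment> \<open>The action of L carried over to C[t]; once it is identified with some
    \<open>Omega_act\<close>, \<open>\<phi>\<close> itself is the isomorphism.\<close>
  define T where "T x p = \<phi> (op (gen x) (\<Phi> p))" for x p
  have \<Phi>_\<phi>: "\<Phi> (\<phi> w) = w" if "w \<in> carrier M" for w
    using \<Phi> that by (simp add: \<phi>_def bij_betw_def f_inv_into_f)
  have \<Phi>_T [simp]: "\<Phi> (T x p) = op (gen x) (\<Phi> p)" for x p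
    by (simp add: T_def \<Phi>_\<phi>)
  have "hv_poly_module T"
  proof
    fix x y p q k
    show "T (x + y) p = T x p + T y p"
      by (rule \<Phi>_eq) (simp add: \<Phi>_add op_gen_relations(1) op_add_left)
    show "T (hv_scale k x) p = Polynomial.smult k (T x p)"
      by (rule \<Phi>_eq) (simp add: \<Phi>_smult op_gen_relations(2) op_mult)
    show "T x (p + q) = T x p + T x q"
      by (rule \<Phi>_eq) (simp add: \<Phi>_add op_add_right)
    show "T x (Polynomial.smult k p) = Polynomial.smult k (T x p)"
      by (rule \<Phi>_eq) (simp add: \<Phi>_smult flip: op_mult scalar_commute)
    \<comment> \<open>\<open>\<Phi>_add\<close> transports sums, so the bracket is first shown
      without subtraction.\<close>
    have "T x (T y p) = T (hv_bracket x y) p + T y (T x p)"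
    proof (rule \<Phi>_eq)
      have "\<Phi> (T x (T y p)) = op (gen x * gen y) (\<Phi> p)" by (simp add: op_mult)
      also have "\<dots> = op (gen (hv_bracket x y) + gen y * gen x) (\<Phi> p)"
        by (rule op_gen_relations)
      also have "\<dots> = \<Phi> (T (hv_bracket x y) p + T y (T x p))"
        by (simp add: \<Phi>_add op_add_left op_mult)
      finally show "\<Phi> (T x (T y p)) = \<Phi> (T (hv_bracket x y) p + T y (T x p))" .
    qed
    then show "T (hv_bracket x y) p = T x (T y p) - T y (T x p)" by simp
    show "T ?e p = [:0, 1:] * p"
      by (rule \<Phi>_eq) (simp only: \<Phi>_T \<Phi>_t)
  qed
  then obtain lam \<alpha> \<beta> where lam: "lam \<noteq> 0" and T: "T = Omega_act lam \<alpha> \<beta>"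
    by (rule hv_poly_module.classification)
  have "iso_Omega M lam \<alpha> \<beta>"
    unfolding iso_Omega_iff
  proof (intro exI[of _ \<phi>] conjI ballI allI)
    show "bij_betw \<phi> (carrier M) UNIV"
      unfolding \<phi>_def by (rule bij_betw_inv_into[OF \<Phi>])
  next
    fix v w assume "v \<in> carrier M" "w \<in> carrier M"
    then show "\<phi> (v \<oplus>\<^bsub>M\<^esub> w) = \<phi> v + \<phi> w"
      by (intro \<Phi>_eq) (simp add: \<Phi>_\<phi> \<Phi>_add)
  next
    fix c v assume "v \<in> carrier M"
    then show "\<phi> (op (scalar c) v) = Polynomial.smult c (\<phi> v)"
      by (intro \<Phi>_eq) (simp add: \<Phi>_\<phi> \<Phi>_smult)
  next
    fix x v assume "v \<in> carrier M"
    then show "\<phi> (op (gen x) v) = Omega_act lam \<alpha> \<beta> x (\<phi> v)"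
      by (intro \<Phi>_eq) (simp add: \<Phi>_\<phi> flip: T)
  qed
  with lam show ?thesis by blast
qed

end

section \<open>Simplicity\<close>

lemma Omega_no_invariant_subspace:
  assumes lam: "lam \<noteq> 0" and nz: "\<alpha> \<noteq> 0 \<or> \<beta> \<noteq> 0"
    and add: "\<And>p q. p \<in> W \<Longrightarrow> q \<in> W \<Longrightarrow> p + q \<in> W"
    and smult: "\<And>c p. p \<in> W \<Longrightarrow> Polynomial.smult c p \<in> W"
    and act: "\<And>x p. p \<in> W \<Longrightarrow> Omega_act lam \<alpha> \<beta> x p \<in> W"
    and p: "p \<in> W" "p \<noteq> 0"
  shows "W = UNIV"
proof -
  have t: "[:0, 1:] * q \<in> W" if "q \<in> W" for q
    using act[OF that, of "Poly_Mapping.single (L 0) 1"] by (simp add: pcompose_idR)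
  have ideal: "r * q \<in> W" if "q \<in> W" for q r
  proof (induction r)
    case 0
    show ?case using smult[OF that, of 0] by simp
  next
    case (pCons a r)
    show ?case using add[OF smult[OF that, of a] t[OF pCons.IH]] by simp
  qed
  obtain f where f: "f \<in> W" "f \<noteq> 0" "\<And>q. q \<in> W \<Longrightarrow> q \<noteq> 0 \<Longrightarrow> degree f \<le> degree q"
    using ex_has_least_nat[of "\<lambda>q. q \<in> W \<and> q \<noteq> 0" p degree] p by auto
  have dvd: "f dvd q" if "q \<in> W" for q
  proof -
    \<comment> \<open>The remainder lies in \<open>W\<close> and its degree is below the minimum, so
      it is 0.\<close>
    have "q mod f = q + (- (q div f)) * f" by (simp add: minus_div_mult_eq_mod[symmetric])
    then have "q mod f \<in> W" using add[OF that ideal[OF f(1), of "- (q div f)"]] by simp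
    then show ?thesis using f(3) degree_mod_less'[OF f(2), of q] by fastforce
  qed
  have "constant (poly f)"
  proof (rule ccontr)
    assume "\<not> constant (poly f)"
    then obtain r where r: "poly f r = 0" using fundamental_theorem_of_algebra by blast
    have root: "poly q r = 0" if "q \<in> W" for q
      using dvd[OF that] r by (auto elim!: dvdE)
    \<comment> \<open>The indices for which L_m f or I_m f, both vanishing at r, forces f(r - m) =
      0.\<close>
    define S where "S = {m :: int. \<beta> \<noteq> 0 \<or> r \<noteq> of_int m * \<alpha>}"
    have "poly f (r - of_int m) = 0" if "m \<in> S" for m
      using root[OF act[OF f(1), of "Poly_Mapping.single (L m) 1"]]
        root[OF act[OF f(1), of "Poly_Mapping.single (I m) 1"]] that lam
      by (auto simp: S_def poly_pcompose)
    then have "(\<lambda>m. r - of_int m) ` S \<subseteq> {z. poly f z = 0}" by auto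
    then have "finite ((\<lambda>m. r - of_int m :: complex) ` S)"
      using poly_roots_finite[OF f(2)] finite_subset by blast
    then have fin: "finite S" by (rule finite_imageD) (simp add: inj_on_def)
    \<comment> \<open>Outside \<open>S\<close> one has \<beta> = 0, hence \<alpha> is nonzero and m
      = r / \<alpha>: at most one index.\<close>
    have "UNIV - S \<subseteq> {m. of_int m = r / \<alpha>}" using nz by (auto simp: S_def)
    moreover have "finite {m :: int. of_int m = r / \<alpha>}"
    proof (cases "\<exists>k. of_int k = r / \<alpha>")
      case True
      then obtain k where "r / \<alpha> = of_int k" by metis
      then show ?thesis by simp
    qed simp
    ultimately have "finite (UNIV - S)" by (rule finite_subset)
    with fin show False using infinite_UNIV_int by simp
  qed
  then obtain k where "f = [:k:]" using constant_degree degree_eq_zeroE by metis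
  with f have "k \<noteq> 0" "[:k:] \<in> W" by auto
  then have "r \<in> W" for r using ideal[of "[:k:]" "Polynomial.smult (inverse k) r"] by simp
  then show ?thesis by blast
qed

text \<open>Each L_m f is now a multiple of t, while the other basis elements act as 0.\<close>

lemma Omega_act_vanishes_0: "poly (Omega_act lam 0 0 x p) 0 = 0"
proof -
  have "poly (Omega_basis lam 0 0 a p) 0 = 0" for a by (cases a) simp_all
  then show ?thesis by (simp add: Omega_act_def poly_sum)
qed

context hv_uea_module
begin

interpretation left_module U_hv M by (rule left_module)

text \<open>Stated for an arbitrary isomorphism: simplicity excludes \<alpha> = \<beta> = 0 for the
  one constructed in \<open>exists_iso_Omega\<close>, and any given one with a nonzero parameter
  yields simplicity.\<close>

lemma simple_iff:
  assumes lam: "lam \<noteq> 0" and iso: "iso_Omega M lam \<alpha> \<beta>"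
  shows "simple_module U_hv M \<longleftrightarrow> \<alpha> \<noteq> 0 \<or> \<beta> \<noteq> 0"
proof -
  obtain \<phi> where bij: "bij_betw \<phi> (carrier M) UNIV"
    and add: "\<And>v w. v \<in> carrier M \<Longrightarrow> w \<in> carrier M \<Longrightarrow> \<phi> (v \<oplus>\<^bsub>M\<^esub> w) = \<phi> v + \<phi> w"
    and smult: "\<And>c v. v \<in> carrier M \<Longrightarrow> \<phi> (op (scalar c) v) = Polynomial.smult c (\<phi> v)"
    and act: "\<And>x v. v \<in> carrier M \<Longrightarrow> \<phi> (op (gen x) v) = Omega_act lam \<alpha> \<beta> x (\<phi> v)"
    using iso unfolding iso_Omega_iff by metis
  have zero: "\<phi> \<zero>\<^bsub>M\<^esub> = 0"
    using add[of "\<zero>\<^bsub>M\<^esub>" "\<zero>\<^bsub>M\<^esub>"] by simp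
  have inj: "v = w" if "\<phi> v = \<phi> w" "v \<in> carrier M" "w \<in> carrier M" for v w
    using bij that by (auto simp: bij_betw_def inj_on_def)
  have surj: "\<exists>v\<in>carrier M. \<phi> v = p" for p
    using bij by (auto simp: bij_betw_def image_iff) (metis UNIV_I imageE)
  show ?thesis
  proof
    assume simple: "simple_module U_hv M"
    show "\<alpha> \<noteq> 0 \<or> \<beta> \<noteq> 0"
    proof (rule ccontr)
      assume "\<not> (\<alpha> \<noteq> 0 \<or> \<beta> \<noteq> 0)"
      then have 0: "\<alpha> = 0" "\<beta> = 0" by auto
      \<comment> \<open>The preimage of t C[t]; the preimages of t and 1 show that it is neither
        zero nor everything.\<close>
      define N where "N = {v \<in> carrier M. poly (\<phi> v) 0 = 0}"
      have "submodule N U_hv M"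
      proof (rule submoduleI)
        show "subgroup N (add_monoid M)"
        proof (rule add.subgroupI)
          fix v assume v: "v \<in> N"
          then have "\<phi> v + \<phi> (\<ominus>\<^bsub>M\<^esub> v) = 0"
            using add[of v "\<ominus>\<^bsub>M\<^esub> v"] by (simp add: N_def zero M.r_neg)
          then have "poly (\<phi> v) 0 + poly (\<phi> (\<ominus>\<^bsub>M\<^esub> v)) 0 = 0" by (metis poly_0 poly_add)
          with v show "\<ominus>\<^bsub>M\<^esub> v \<in> N" by (simp add: N_def)
        qed (use zero in \<open>auto simp: N_def add\<close>)
      qed (auto simp: N_def smult act 0 Omega_act_vanishes_0)
      then have "N = {\<zero>\<^bsub>M\<^esub>} \<or> N = carrier M"
        using simple by (simp add: simple_module_def)
      moreover obtain v where "v \<in> carrier M" "\<phi> v = [:0, 1:]" using surj by metis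
      then have "v \<in> N" "v \<noteq> \<zero>\<^bsub>M\<^esub>" using zero by (auto simp: N_def)
      moreover obtain w where "w \<in> carrier M" "\<phi> w = 1" using surj by metis
      then have "w \<in> carrier M" "w \<notin> N" by (auto simp: N_def)
      ultimately show False by blast
    qed
  next
    assume nz: "\<alpha> \<noteq> 0 \<or> \<beta> \<noteq> 0"
    show "simple_module U_hv M"
      unfolding simple_module_def
    proof (intro conjI allI impI)
      obtain v where "v \<in> carrier M" "\<phi> v = 1" using surj by metis
      with zero show "carrier M \<noteq> {\<zero>\<^bsub>M\<^esub>}" by auto
    next
      fix N assume "submodule N U_hv M"
      then interpret N: submodule N U_hv M .
      have sub: "v \<in> carrier M" if "v \<in> N" for v using N.subset that by auto
      show "N = {\<zero>\<^bsub>M\<^esub>} \<or> N = carrier M"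
      proof (rule disjCI)
        assume "N \<noteq> carrier M"
        have "\<phi> ` N \<noteq> UNIV"
        proof
          assume "\<phi> ` N = UNIV"
          have "v \<in> N" if "v \<in> carrier M" for v
          proof -
            obtain w where "w \<in> N" "\<phi> w = \<phi> v" using \<open>\<phi> ` N = UNIV\<close> by (metis UNIV_I imageE)
            with inj that sub show ?thesis by metis
          qed
          with sub \<open>N \<noteq> carrier M\<close> show False by auto
        qed
        have "\<phi> v = 0" if "v \<in> N" for v
        proof (rule ccontr)
          assume "\<phi> v \<noteq> 0"
          have "op f w \<in> N" if "w \<in> N" for f w
            using N.smult_closed that by (simp add: op_def U_hv_carrier)
          moreover have "v \<oplus>\<^bsub>M\<^esub> w \<in> N" if "v \<in> N" "w \<in> N" for v w
            using N.m_closed that by simp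
          ultimately have "\<phi> ` N = UNIV"
            using \<open>\<phi> v \<noteq> 0\<close> that sub
            by (intro Omega_no_invariant_subspace[OF lam nz, of _ "\<phi> v"])
              (auto simp flip: add smult act)
          with \<open>\<phi> ` N \<noteq> UNIV\<close> show False ..
        qed
        then have "v = \<zero>\<^bsub>M\<^esub>" if "v \<in> N" for v
          using inj[of v "\<zero>\<^bsub>M\<^esub>"] that zero sub by simp
        moreover have "\<zero>\<^bsub>M\<^esub> \<in> N" using N.one_closed by simp
        ultimately show "N = {\<zero>\<^bsub>M\<^esub>}" by blast
      qed
    qed (rule left_module)
  qed
qed

end

theorem theorem2:
  fixes M :: "(hv free_elem set, 'm) module"
  assumes "left_module U_hv M"
    and "free_of_rank_one U_CL0 (restrict_to_U_CL0 M)"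
  shows "(\<exists>lam \<alpha> \<beta>. lam \<noteq> 0 \<and> iso_Omega M lam \<alpha> \<beta>) \<and>
    (simple_module U_hv M \<longleftrightarrow>
      (\<exists>lam \<alpha> \<beta>. lam \<noteq> 0 \<and> (\<alpha> \<noteq> 0 \<or> \<beta> \<noteq> 0) \<and> iso_Omega M lam \<alpha> \<beta>))"
proof -
  interpret hv_uea_module M by (rule hv_uea_module.intro) (rule assms(1))
  show ?thesis
    using exists_iso_Omega[OF assms(2)] simple_iff by blast
qed

end
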